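(* Let $(\mathfrak g,\alpha_{\mathfrak g})$ be a Hom-vector space and let $\pi_1,\pi_2\in C^2_{\mathrm H}(\mathfrak g,\mathfrak g)$ satisfy $\pi_i(a,b,c)+\pi_i(b,c,a)+\pi_i(c,a,b)=0$ for $i=1,2$ and all $a,b,c\in\mathfrak g$. Then $(\mathfrak g,\pi_1,\pi_2,\alpha_{\mathfrak g})$ is a compatible Hom-Lie triple system if and only if $(\pi_1,\pi_2)$ is a Maurer-Cartan element of the bidifferential graded Lie algebra $(C^{*}_{\mathrm H}(\mathfrak g,\mathfrak g),[-,-]_{\mathrm{Hlts}},d_1=0,d_2=0)$.
   Context: All vector spaces and (multi)linear maps are over a field $\mathbb K$ of characteristic zero. A Hom-vector space $(\mathfrak g,\alpha_{\mathfrak g})$ is a vector space with a linear map $\alpha_{\mathfrak g}:\mathfrak g\to\mathfrak g$. A Hom-Lie triple system $(\mathfrak g,[-,-,-]_{\mathfrak g},\alpha_{\mathfrak g})$ is a vector space $\mathfrak g$ with a trilinear operation and a linear map $\alpha=\alpha_{\mathfrak g}$ such that $\alpha([x,y,z])=[\alpha(x),\alpha(y),\alpha(z)]$, $[x,y,z]+[y,x,z]=0$, $[x,y,z]+[z,x,y]+[y,z,x]=0$, and $[\alpha(a),\alpha(b),[x,y,z]]=[[a,b,x],\alpha(y),\alpha(z)]+[\alpha(x),[a,b,y],\alpha(z)]+[\alpha(x),\alpha(y),[a,b,z]]$ for all $a,b,x,y,z\in\mathfrak g$. A compatible Hom-Lie triple system $(\mathfrak g,[-,-,-]^1,[-,-,-]^2,\alpha)$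 consists of two Hom-Lie triple systems $(\mathfrak g,[-,-,-]^1,\alpha)$ and $(\mathfrak g,[-,-,-]^2,\alpha)$ such that for all $a,b,x,y,z$: $[\alpha(a),\alpha(b),[x,y,z]^2]^1+[\alpha(a),\alpha(b),[x,y,z]^1]^2=[[a,b,x]^1,\alpha(y),\alpha(z)]^2+[[a,b,x]^2,\alpha(y),\alpha(z)]^1+[\alpha(x),[a,b,y]^1,\alpha(z)]^2+[\alpha(x),[a,b,y]^2,\alpha(z)]^1+[\alpha(x),\alpha(y),[a,b,z]^1]^2+[\alpha(x),\alpha(y),[a,b,z]^2]^1.$ The spaces $C^n_{\mathrm H}(\mathfrak g,\mathfrak g)$: $C^1_{\mathrm H}(\mathfrak g,\mathfrak g)$ is the space of linear $f:\mathfrak g\to\mathfrak g$ with $\alpha\circ f=f\circ\alpha$; for $n\ge1$, $C^{n+1}_{\mathrm H}(\mathfrak g,\mathfrak g)$ is the space of linear maps $f:(\wedge^2\mathfrak g)^{\otimes n}\otimes\mathfrak g\to\mathfrak g$ with $\alpha\circ f=f\circ((\alpha^{\wedge2})^{\otimes n}\otimes\alpha)$. An element $\pi\in C^2_{\mathrm H}$ is viewed as a trilinear map, $\pi(a,b,c)=\pi(a\wedge b,c)$, skew in the first two arguments. The graded space $C^{*}_{\mathrm H}(\mathfrak g,\mathfrak g)=\bigoplus_{n\ge0}C^{n+1}_{\mathrm H}(\mathfrak g,\mathfrak g)$, with $C^{n+1}_{\mathrm H}$ in degree $n$, is a graded Lie algebra with bracket $[P,Q]_{\mathrm{Hlts}}=P\diamond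 Q-(-1)^{pq}Q\diamond P$ for $P\in C^{p+1}_{\mathrm H}$, $Q\in C^{q+1}_{\mathrm H}$, where for $\mathfrak A_i=a_i\wedge b_i\in\wedge^2\mathfrak g$, $c\in\mathfrak g$ (with $\alpha^q(\mathfrak A_i)=\alpha^q(a_i)\wedge\alpha^q(b_i)$), $$\begin{aligned}P\diamond Q(\mathfrak A_1,\dots,\mathfrak A_{p+q},c)=&\sum_{\sigma\in\mathbb S(p,q)}(-1)^{pq}\mathrm{sgn}(\sigma)\,P(\alpha^q(\mathfrak A_{\sigma(1)}),\dots,\alpha^q(\mathfrak A_{\sigma(p)}),Q(\mathfrak A_{\sigma(p+1)},\dots,\mathfrak A_{\sigma(p+q)},c))\\&+\sum_{k=1}^p\sum_{\sigma\in\mathbb S(k-1,q)}(-1)^{(k-1)q}\mathrm{sgn}(\sigma)\,P\big(\alpha^q(\mathfrak A_{\sigma(1)}),\dots,\alpha^q(\mathfrak A_{\sigma(k-1)}),\\&\qquad \alpha^q(a_{k+q})\wedge Q(\mathfrak A_{\sigma(k)},\dots,\mathfrak A_{\sigma(k+q-1)},b_{k+q})+Q(\mathfrak A_{\sigma(k)},\dots,\mathfrak A_{\sigma(k+q-1)},a_{k+q})\wedge\alpha^q(b_{k+q}),\\&\qquad\alpha^q(\mathfrak A_{k+q+1}),\dots,\alpha^q(\mathfrak A_{p+q}),\alpha^q(c)\big),\end{aligned}$$ and $\mathbb S(i,m-i)$ is the set of $(i,m-i)$-unshuffles: permutations with $\sigma(1)<\dots<\sigma(i)$ and $\sigma(i+1)<\dots<\sigma(m)$.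 A differential graded Lie algebra is a graded Lie algebra $(L=\bigoplus_{i\ge0}L^i,[-,-])$ with a differential $d$ of degree $1$ satisfying $d[a,b]=[da,b]+(-1)^k[a,db]$ for $a\in L^k$. A Maurer-Cartan element of it is $\pi\in L^1$ with $d\pi+\frac12[\pi,\pi]=0$. A bidifferential graded Lie algebra $(L,[-,-],d_1,d_2)$ is a graded Lie algebra such that $(L,[-,-],d_1)$ and $(L,[-,-],d_2)$ are differential graded Lie algebras and $d_1d_2+d_2d_1=0$. A Maurer-Cartan element of it is a pair $(\pi_1,\pi_2)\in L^1\oplus L^1$ such that $\pi_i$ is a Maurer-Cartan element of $(L,[-,-],d_i)$ for $i=1,2$ and $d_1\pi_2+d_2\pi_1+[\pi_1,\pi_2]=0$. *)

theory Defs
  imports Complex_Main "HOL-Library.Function_Algebras" "HOL-Combinatorics.Permutations"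
begin

section \<open>Hom-Lie triple systems\<close>

locale hom_vector_space = vector_space scale
  for scale :: "'k::field_char_0 \<Rightarrow> 'v::ab_group_add \<Rightarrow> 'v" +
  fixes \<alpha> :: "'v \<Rightarrow> 'v"
  assumes linear_twist: "Vector_Spaces.linear scale scale \<alpha>"

locale hom_lie_triple_system = hom_vector_space scale \<alpha>
  for scale :: "'k::field_char_0 \<Rightarrow> 'v::ab_group_add \<Rightarrow> 'v" and \<alpha> :: "'v \<Rightarrow> 'v" +
  fixes T :: "'v \<Rightarrow> 'v \<Rightarrow> 'v \<Rightarrow> 'v"
  assumes linear1: "Vector_Spaces.linear scale scale (\<lambda>x. T x y z)"
    and linear2: "Vector_Spaces.linear scale scale (\<lambda>y. T x y z)"
    and linear3: "Vector_Spaces.linear scale scale (\<lambda>z. T x y z)"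
    and multiplicative: "\<alpha> (T x y z) = T (\<alpha> x) (\<alpha> y) (\<alpha> z)"
    and skew: "T x y z + T y x z = 0"
    and cyclic: "T x y z + T z x y + T y z x = 0"
    and fundamental:
      "T (\<alpha> a) (\<alpha> b) (T x y z) =
         T (T a b x) (\<alpha> y) (\<alpha> z) + T (\<alpha> x) (T a b y) (\<alpha> z) + T (\<alpha> x) (\<alpha> y) (T a b z)"

locale compatible_hom_lie_triple_system =
  H1: hom_lie_triple_system scale \<alpha> T1 + H2: hom_lie_triple_system scale \<alpha> T2
  for scale :: "'k::field_char_0 \<Rightarrow> 'v::ab_group_add \<Rightarrow> 'v"
    and T1 T2 :: "'v \<Rightarrow> 'v \<Rightarrow> 'v \<Rightarrow> 'v" and \<alpha> :: "'v \<Rightarrow> 'v" +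
  assumes compatible:
    "T1 (\<alpha> a) (\<alpha> b) (T2 x y z) + T2 (\<alpha> a) (\<alpha> b) (T1 x y z) =
       T2 (T1 a b x) (\<alpha> y) (\<alpha> z) + T1 (T2 a b x) (\<alpha> y) (\<alpha> z) +
       T2 (\<alpha> x) (T1 a b y) (\<alpha> z) + T1 (\<alpha> x) (T2 a b y) (\<alpha> z) +
       T2 (\<alpha> x) (\<alpha> y) (T1 a b z) + T1 (\<alpha> x) (\<alpha> y) (T2 a b z)"


section \<open>Bidifferential graded Lie algebras\<close>

text \<open>
  A graded space \<open>\<Oplus>\<^sub>i L\<^sup>i\<close> is given by the family of its homogeneous components \<open>L i\<close>,
  subspaces of one ambient vector space that only supplies the linear operations (the sum
  is external). Bracket and differentials are given on homogeneous elements, with the degrees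
  as arguments: \<open>br i j : L i \<times> L j \<rightarrow> L (i + j)\<close> and \<open>d i : L i \<rightarrow> L (i + 1)\<close>.
  By (bi)linearity this determines them on the direct sum.
\<close>

locale graded_lie_algebra = vector_space scale
  for scale :: "'k::field_char_0 \<Rightarrow> 'a::ab_group_add \<Rightarrow> 'a" +
  fixes L :: "nat \<Rightarrow> 'a set"
    and br :: "nat \<Rightarrow> nat \<Rightarrow> 'a \<Rightarrow> 'a \<Rightarrow> 'a"
  assumes subspace_component: "module.subspace scale (L i)"
    and br_closed: "\<lbrakk>a \<in> L i; b \<in> L j\<rbrakk> \<Longrightarrow> br i j a b \<in> L (i + j)"
    and br_add_left:
      "\<lbrakk>a \<in> L i; a' \<in> L i; b \<in> L j\<rbrakk> \<Longrightarrow> br i j (a + a') b = br i j a b + br i j a' b"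
    and br_scale_left:
      "\<lbrakk>a \<in> L i; b \<in> L j\<rbrakk> \<Longrightarrow> br i j (scale r a) b = scale r (br i j a b)"
    and br_add_right:
      "\<lbrakk>a \<in> L i; b \<in> L j; b' \<in> L j\<rbrakk> \<Longrightarrow> br i j a (b + b') = br i j a b + br i j a b'"
    and br_scale_right:
      "\<lbrakk>a \<in> L i; b \<in> L j\<rbrakk> \<Longrightarrow> br i j a (scale r b) = scale r (br i j a b)"
    and br_skew:
      "\<lbrakk>a \<in> L i; b \<in> L j\<rbrakk> \<Longrightarrow> br i j a b = - scale ((-1) ^ (i * j)) (br j i b a)"
    and br_jacobi:
      "\<lbrakk>a \<in> L i; b \<in> L j; c \<in> L k\<rbrakk> \<Longrightarrow>
         br i (j + k) a (br j k b c) =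
           br (i + j) k (br i j a b) c + scale ((-1) ^ (i * j)) (br j (i + k) b (br i k a c))"

locale dg_lie_algebra = graded_lie_algebra scale L br
  for scale :: "'k::field_char_0 \<Rightarrow> 'a::ab_group_add \<Rightarrow> 'a" and L br +
  fixes d :: "nat \<Rightarrow> 'a \<Rightarrow> 'a"
  assumes d_closed: "a \<in> L i \<Longrightarrow> d i a \<in> L (i + 1)"
    and d_add: "\<lbrakk>a \<in> L i; a' \<in> L i\<rbrakk> \<Longrightarrow> d i (a + a') = d i a + d i a'"
    and d_scale: "a \<in> L i \<Longrightarrow> d i (scale r a) = scale r (d i a)"
    and d_d: "a \<in> L i \<Longrightarrow> d (i + 1) (d i a) = 0"
    and d_leibniz:
      "\<lbrakk>a \<in> L i; b \<in> L j\<rbrakk> \<Longrightarrow>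
         d (i + j) (br i j a b) =
           br (i + 1) j (d i a) b + scale ((-1) ^ i) (br i (j + 1) a (d j b))"

locale dg_maurer_cartan = dg_lie_algebra scale L br d
  for scale :: "'k::field_char_0 \<Rightarrow> 'a::ab_group_add \<Rightarrow> 'a" and L br d +
  fixes \<pi> :: 'a
  assumes degree_one: "\<pi> \<in> L 1"
    and maurer_cartan: "d 1 \<pi> + scale (1 / 2) (br 1 1 \<pi> \<pi>) = 0"

locale bidg_lie_algebra =
  D1: dg_lie_algebra scale L br d1 + D2: dg_lie_algebra scale L br d2
  for scale :: "'k::field_char_0 \<Rightarrow> 'a::ab_group_add \<Rightarrow> 'a" and L br d1 d2 +
  assumes anticommute: "a \<in> L i \<Longrightarrow> d1 (i + 1) (d2 i a) + d2 (i + 1) (d1 i a) = 0"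

locale bidg_maurer_cartan =
  bidg_lie_algebra scale L br d1 d2 +
  M1: dg_maurer_cartan scale L br d1 \<pi>1 + M2: dg_maurer_cartan scale L br d2 \<pi>2
  for scale :: "'k::field_char_0 \<Rightarrow> 'a::ab_group_add \<Rightarrow> 'a" and L br d1 d2 \<pi>1 \<pi>2 +
  assumes mixed: "d1 1 \<pi>2 + d2 1 \<pi>1 + br 1 1 \<pi>1 \<pi>2 = 0"


section \<open>The graded Lie algebra of a Hom-vector space\<close>

text \<open>
  A linear map \<open>(\<And>\<^sup>2 g)\<^sup>\<otimes>\<^sup>n \<otimes> g \<rightarrow> g\<close> is given by its values
  \<open>P [(a\<^sub>1, b\<^sub>1), \<dots>, (a\<^sub>n, b\<^sub>n)] c\<close> on decomposable elements, the pair \<open>(a, b)\<close>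
  standing for \<open>a \<and> b\<close>; these are the maps that are multilinear in all arguments and
  alternating in each pair. The value is \<open>0\<close> on lists of length other than \<open>n\<close>, so that equality
  of cochains is equality of functions.
\<close>

type_synonym 'v cochain = "('v \<times> 'v) list \<Rightarrow> 'v \<Rightarrow> 'v"

definition cochain_scale :: "('k \<Rightarrow> 'v \<Rightarrow> 'v) \<Rightarrow> 'k \<Rightarrow> 'v cochain \<Rightarrow> 'v cochain" where
  "cochain_scale scale r P = (\<lambda>As c. scale r (P As c))"

text \<open>Cochains are indexed by degree: \<open>hom_cochains scale \<alpha> n\<close> is \<open>C\<^sup>n\<^sup>+\<^sup>1\<close>.\<close>

definition hom_cochains ::
    "('k::field_char_0 \<Rightarrow> 'v::ab_group_add \<Rightarrow> 'v) \<Rightarrow> ('v \<Rightarrow> 'v) \<Rightarrow> nat \<Rightarrow> 'v cochain set" where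
  "hom_cochains scale \<alpha> n = {P.
     (\<forall>As c. length As \<noteq> n \<longrightarrow> P As c = 0) \<and>
     (\<forall>As. length As = n \<longrightarrow> Vector_Spaces.linear scale scale (P As)) \<and>
     (\<forall>As c i y. length As = n \<and> i < n \<longrightarrow>
        Vector_Spaces.linear scale scale (\<lambda>x. P (As[i := (x, y)]) c) \<and>
        Vector_Spaces.linear scale scale (\<lambda>x. P (As[i := (y, x)]) c) \<and>
        P (As[i := (y, y)]) c = 0) \<and>
     (\<forall>As c. length As = n \<longrightarrow> \<alpha> (P As c) = P (map (map_prod \<alpha> \<alpha>) As) (\<alpha> c))}"

text \<open>
  Permutations act on \<open>{0, \<dots>, i + j - 1}\<close>; positions in lists count from \<open>0\<close>.
\<close>

definition unshuffles :: "nat \<Rightarrow> nat \<Rightarrow> (nat \<Rightarrow> nat) set" where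
  "unshuffles i j =
     {\<sigma>. \<sigma> permutes {..<i + j} \<and> strict_mono_on {..<i} \<sigma> \<and> strict_mono_on {i..<i + j} \<sigma>}"

text \<open>
  The operation \<open>P \<diamond> Q\<close> for \<open>P\<close> of degree \<open>p\<close> and \<open>Q\<close> of degree \<open>q\<close>. Counting from \<open>0\<close>, the
  summation index \<open>k\<close> below is one less than in the usual formula, so that the distinguished
  argument \<open>a \<and> b\<close> is at position \<open>k + q\<close>. The value of \<open>P\<close> at
  \<open>\<alpha>\<^sup>q(a) \<and> Q(\<dots>, b) + Q(\<dots>, a) \<and> \<alpha>\<^sup>q(b)\<close> is expanded into its two summands.
\<close>

definition hlts_circ ::
    "('k::field_char_0 \<Rightarrow> 'v::ab_group_add \<Rightarrow> 'v) \<Rightarrow> ('v \<Rightarrow> 'v) \<Rightarrow> nat \<Rightarrow> nat \<Rightarrow>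
     'v cochain \<Rightarrow> 'v cochain \<Rightarrow> 'v cochain" where
  "hlts_circ scale \<alpha> p q P Q As c =
     (if length As \<noteq> p + q then 0 else
       (let \<alpha>q = \<alpha> ^^ q; \<alpha>q2 = map_prod \<alpha>q \<alpha>q in
        (\<Sum>\<sigma>\<in>unshuffles p q.
           scale ((-1) ^ (p * q) * of_int (sign \<sigma>))
             (P (map (\<lambda>i. \<alpha>q2 (As ! \<sigma> i)) [0..<p])
                (Q (map (\<lambda>i. As ! \<sigma> i) [p..<p + q]) c))) +
        (\<Sum>k<p. \<Sum>\<sigma>\<in>unshuffles k q.
           let before = map (\<lambda>i. \<alpha>q2 (As ! \<sigma> i)) [0..<k];
               Q' = Q (map (\<lambda>i. As ! \<sigma> i) [k..<k + q]);
               (a, b) = As ! (k + q);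
               after = map (\<lambda>i. \<alpha>q2 (As ! i)) [k + q + 1..<p + q]
           in scale ((-1) ^ (k * q) * of_int (sign \<sigma>))
                (P (before @ [(\<alpha>q a, Q' b)] @ after) (\<alpha>q c) +
                 P (before @ [(Q' a, \<alpha>q b)] @ after) (\<alpha>q c)))))"

definition hlts_bracket ::
    "('k::field_char_0 \<Rightarrow> 'v::ab_group_add \<Rightarrow> 'v) \<Rightarrow> ('v \<Rightarrow> 'v) \<Rightarrow> nat \<Rightarrow> nat \<Rightarrow>
     'v cochain \<Rightarrow> 'v cochain \<Rightarrow> 'v cochain" where
  "hlts_bracket scale \<alpha> p q P Q =
     hlts_circ scale \<alpha> p q P Q - cochain_scale scale ((-1) ^ (p * q)) (hlts_circ scale \<alpha> q p Q P)"

definition trilinear_of :: "'v cochain \<Rightarrow> 'v \<Rightarrow> 'v \<Rightarrow> 'v \<Rightarrow> 'v" where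
  "trilinear_of \<pi> a b c = \<pi> [(a, b)] c"

end

(*
The condition on (pi1, pi2) unfolds directly in degree one: [P, Q] evaluated on two bivectors and a
vector is the difference of the two sides of the (polarised) fundamental identity, and [pi, pi] is
twice that difference for P = Q = pi. The substance is that the bracket is a graded Lie bracket, for
which it suffices that P <> Q is a graded right pre-Lie product: its associator
(P <> Q) <> R - P <> (Q <> R) is graded symmetric in Q and R.

Instead of sums over unshuffles, use the recursion obtained by deciding where the first bivector A
goes: into the first slot of P, or into the first slot of Q, or, if no slot of Q is left, it is the
bivector on which Q acts as a derivation. The pre-Lie identity then follows by induction on the
number of bivectors. Contracting Q with A destroys its equivariance under the twist, so the
induction carries along, for each of Q and R, a companion cochain that intertwines the twist.
*)
theory Submission
  imports Defs
begin

section \<open>Unshuffles, decomposed by the position of the value \<open>0\<close>\<close>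

section \<open>Unshuffles\<close>

text \<open>The embedding of the permutations of \<open>{..<n}\<close> into those of
  \<open>{..<Suc n}\<close> as the stabiliser of \<open>0\<close>.\<close>

definition perm_lift :: "(nat \<Rightarrow> nat) \<Rightarrow> nat \<Rightarrow> nat" where
  "perm_lift \<tau> i = (case i of 0 \<Rightarrow> 0 | Suc j \<Rightarrow> Suc (\<tau> j))"

lemma perm_lift_simps [simp]: "perm_lift \<tau> 0 = 0" "perm_lift \<tau> (Suc j) = Suc (\<tau> j)"
  by (simp_all add: perm_lift_def)

lemma perm_lift_inject: "perm_lift \<sigma> = perm_lift \<tau> \<longleftrightarrow> \<sigma> = \<tau>"
proof
  assume *: "perm_lift \<sigma> = perm_lift \<tau>"
  show "\<sigma> = \<tau>"
  proof
    fix i show "\<sigma> i = \<tau> i" using fun_cong[OF *, of "Suc i"] by simp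
  qed
qed simp

text \<open>As a transport along the injection \<open>Suc\<close>, the lift inherits both
  permutation property and sign from general facts.\<close>

lemma perm_lift_eq_map_permutation:
  assumes "\<tau> permutes {..<n}"
  shows "perm_lift \<tau> = map_permutation {..<n} Suc \<tau>"
proof
  fix i show "perm_lift \<tau> i = map_permutation {..<n} Suc \<tau> i"
  proof (cases "i \<in> Suc ` {..<n}")
    case True
    then show ?thesis using assms by (auto simp: map_permutation_apply)
  next
    case False
    then have "perm_lift \<tau> i = i"
      using assms by (cases i) (auto simp: permutes_def)
    with False show ?thesis by (simp add: map_permutation_def)
  qed
qed

lemma perm_lift_permutes:
  assumes "\<tau> permutes {..<n}"
  shows "perm_lift \<tau> permutes {..<Suc n}"
proof -
  have "map_permutation {..<n} Suc \<tau> permutes Suc ` {..<n}"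
    using assms by (intro map_permutation_permutes) (auto simp: bij_betw_def)
  then show ?thesis
    unfolding perm_lift_eq_map_permutation[OF assms] by (rule permutes_subset) auto
qed

lemma sign_perm_lift:
  assumes "\<tau> permutes {..<n}"
  shows "sign (perm_lift \<tau>) = sign \<tau>"
  unfolding perm_lift_eq_map_permutation[OF assms] by (rule sign_map_permutation) (use assms in auto)

text \<open>Injectivity keeps \<open>\<sigma> (Suc i)\<close> away from \<open>0\<close>, so
  subtracting \<open>1\<close> from it loses nothing.\<close>

lemma perm_lift_surj:
  assumes \<sigma>: "\<sigma> permutes {..<Suc n}" and "\<sigma> 0 = 0"
  obtains \<tau> where "\<tau> permutes {..<n}" "\<sigma> = perm_lift \<tau>"
proof
  let ?\<tau> = "\<lambda>i. \<sigma> (Suc i) - 1"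
  have pos: "\<sigma> (Suc i) > 0" for i
    using inj_eq[OF permutes_inj[OF \<sigma>], of "Suc i" 0] \<open>\<sigma> 0 = 0\<close> by simp
  show "\<sigma> = perm_lift ?\<tau>"
  proof
    fix i show "\<sigma> i = perm_lift ?\<tau> i"
      using \<open>\<sigma> 0 = 0\<close> pos by (cases i) simp_all
  qed
  show "?\<tau> permutes {..<n}"
  proof (rule bij_imp_permutes)
    have "inj_on ?\<tau> {..<n}"
    proof (rule inj_onI)
      fix i j assume "\<sigma> (Suc i) - 1 = \<sigma> (Suc j) - 1"
      then have "\<sigma> (Suc i) = \<sigma> (Suc j)" using pos[of i] pos[of j] by linarith
      then show "i = j" using permutes_inj[OF \<sigma>] by (simp add: inj_eq)
    qed
    moreover have "\<sigma> (Suc i) - 1 < n" if "i < n" for i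
      using permutes_in_image[OF \<sigma>, of "Suc i"] pos[of i] that by simp
    then have "?\<tau> ` {..<n} \<subseteq> {..<n}" by auto
    ultimately show "bij_betw ?\<tau> {..<n} {..<n}"
      by (simp add: bij_betw_def endo_inj_surj)
    show "?\<tau> i = i" if "i \<notin> {..<n}" for i
      using permutes_not_in[OF \<sigma>, of "Suc i"] that by simp
  qed
qed

text \<open>The cycle on \<open>0, ..., m\<close>. Precomposing a lift with it moves the value
  \<open>0\<close> to position \<open>m\<close> and keeps the order of the other values.\<close>

definition front_cycle :: "nat \<Rightarrow> nat \<Rightarrow> nat" where
  "front_cycle m i = (if i < m then Suc i else if i = m then 0 else i)"

text \<open>A factorisation into \<open>m\<close> adjacent transpositions, one at a time; it yields
  both the permutation property and the sign by induction.\<close>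

lemma front_cycle_Suc: "front_cycle (Suc m) = front_cycle m \<circ> transpose m (Suc m)"
  by (auto simp: fun_eq_iff front_cycle_def transpose_def)

lemma front_cycle_permutes: "m < n \<Longrightarrow> front_cycle m permutes {..<n}"
proof (induction m)
  case 0
  have "front_cycle 0 = id" by (auto simp: front_cycle_def)
  then show ?case by (simp only: permutes_id)
next
  case (Suc m)
  then show ?case unfolding front_cycle_Suc by (intro permutes_compose permutes_swap_id) auto
qed

lemma sign_front_cycle: "sign (front_cycle m) = (-1) ^ m"
proof (induction m)
  case 0
  have "front_cycle 0 = id" by (auto simp: front_cycle_def)
  then show ?case by (simp only: sign_id power_0)
next
  case (Suc m)
  have "permutation (front_cycle m)"
    using front_cycle_permutes[of m "Suc m"] by (auto simp: permutation_permutes)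
  then show ?case
    unfolding front_cycle_Suc
    by (subst sign_compose) (simp_all add: permutation_swap_id sign_swap_id Suc)
qed

text \<open>Strict monotonicity gives \<open>i \<le> \<sigma> i\<close>, while a permutation
  preserves the sum of all indices below \<open>n\<close>; hence no inequality can be
  strict.\<close>

lemma strict_mono_on_permutes_id:
  fixes \<sigma> :: "nat \<Rightarrow> nat"
  assumes "\<sigma> permutes {..<n}" "strict_mono_on {..<n} \<sigma>"
  shows "\<sigma> = id"
proof
  fix i
  have ge: "i \<le> \<sigma> i" if "i < n" for i
    using that
  proof (induction i)
    case (Suc i)
    then show ?case using strict_mono_onD[OF assms(2), of i "Suc i"] by auto
  qed simp
  have "(\<Sum>i<n. \<sigma> i) = (\<Sum>i<n. i)"
    using sum.permute[OF assms(1), of "\<lambda>i. i"] by (simp add: comp_def)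
  then have "\<sigma> i = i" if "i < n" for i
    using sum_strict_mono_ex1[of "{..<n}" "\<lambda>i. i" \<sigma>] ge that
    by (metis finite_lessThan le_neq_implies_less lessThan_iff nat_neq_iff)
  then show "\<sigma> i = id i"
    using permutes_not_in[OF assms(1), of i] by (cases "i < n") auto
qed

lemma unshuffles_0_left: "unshuffles 0 q = {id}"
  by (auto simp: unshuffles_def permutes_id strict_mono_on_def atLeast0LessThan
      dest: strict_mono_on_permutes_id)

lemma unshuffles_0_right: "unshuffles p 0 = {id}"
  by (auto simp: unshuffles_def permutes_id strict_mono_on_def
      dest: strict_mono_on_permutes_id)

text \<open>The least value \<open>0\<close> must stand at the start of one of the two increasing
  blocks. This decides whether the first bivector goes to the outer or to the inner cochain.\<close>

lemma unshuffles_Suc_Suc: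
  "unshuffles (Suc p) (Suc q) =
     perm_lift ` unshuffles p (Suc q) \<union>
     (\<lambda>\<tau>. perm_lift \<tau> \<circ> front_cycle (Suc p)) ` unshuffles (Suc p) q" (is "?U = ?A \<union> ?B")
proof
  show "?A \<union> ?B \<subseteq> ?U"
  proof safe
    fix \<tau> assume *: "\<tau> \<in> unshuffles p (Suc q)"
    then have "perm_lift \<tau> permutes {..<Suc p + Suc q}"
      using perm_lift_permutes[of \<tau> "p + Suc q"] by (simp add: unshuffles_def)
    with * show "perm_lift \<tau> \<in> ?U"
      by (auto simp: unshuffles_def strict_mono_on_def perm_lift_def split: nat.split)
  next
    fix \<tau> assume *: "\<tau> \<in> unshuffles (Suc p) q"
    then have "perm_lift \<tau> permutes {..<Suc p + Suc q}"
      using perm_lift_permutes[of \<tau> "Suc p + q"] by (simp add: unshuffles_def)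
    then have "perm_lift \<tau> \<circ> front_cycle (Suc p) permutes {..<Suc p + Suc q}"
      by (intro permutes_compose front_cycle_permutes) auto
    with * show "perm_lift \<tau> \<circ> front_cycle (Suc p) \<in> ?U"
      by (auto simp: unshuffles_def strict_mono_on_def front_cycle_def perm_lift_def split: nat.split)
  qed
  show "?U \<subseteq> ?A \<union> ?B"
  proof
    fix \<sigma> assume U: "\<sigma> \<in> ?U"
    then have \<sigma>: "\<sigma> permutes {..<Suc (Suc (p + q))}"
      and mono1: "\<And>i j. i < j \<Longrightarrow> j < Suc p \<Longrightarrow> \<sigma> i < \<sigma> j"
      and mono2: "\<And>i j. Suc p \<le> i \<Longrightarrow> i < j \<Longrightarrow> j < Suc (Suc (p + q)) \<Longrightarrow> \<sigma> i < \<sigma> j"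
      by (auto simp: unshuffles_def strict_mono_on_def)
    obtain i where i: "i < Suc (Suc (p + q))" "\<sigma> i = 0"
      using permutes_image[OF \<sigma>] by (metis imageE lessThan_iff zero_less_Suc)
    have "i = 0 \<or> i = Suc p"
      using mono1[of 0 i] mono2[of "Suc p" i] i by fastforce
    then show "\<sigma> \<in> ?A \<union> ?B"
    proof
      assume "i = 0"
      with i \<sigma> obtain \<tau> where \<tau>: "\<tau> permutes {..<Suc (p + q)}" "\<sigma> = perm_lift \<tau>"
        using perm_lift_surj by blast
      have "\<tau> \<in> unshuffles p (Suc q)"
        using \<tau> mono1[of "Suc _" "Suc _"] mono2[of "Suc _" "Suc _"]
        by (auto simp: unshuffles_def strict_mono_on_def)
      with \<tau>(2) show ?thesis by blast
    next
      assume "i = Suc p"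
      let ?c = "front_cycle (Suc p)"
      have c: "?c permutes {..<Suc (Suc (p + q))}" by (rule front_cycle_permutes) simp
      have cc: "?c (inv ?c j) = j" "inv ?c (?c j) = j" for j
        using permutes_inverses[OF c] by auto
      \<comment> \<open>Undoing the cycle brings the value \<open>0\<close> back to position
        \<open>0\<close>, so that \<open>perm_lift_surj\<close> applies.\<close>
      have "\<sigma> \<circ> inv ?c permutes {..<Suc (Suc (p + q))}"
        using \<sigma> c by (intro permutes_compose permutes_inv)
      moreover have "(\<sigma> \<circ> inv ?c) 0 = 0"
        using cc(2)[of "Suc p"] i \<open>i = Suc p\<close> by (simp add: front_cycle_def)
      ultimately obtain \<tau> where \<tau>: "\<tau> permutes {..<Suc (p + q)}" "\<sigma> \<circ> inv ?c = perm_lift \<tau>"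
        using perm_lift_surj by blast
      then have \<sigma>_eq: "\<sigma> = perm_lift \<tau> \<circ> ?c"
        using cc by (metis comp_apply ext)
      have 1: "\<sigma> j = Suc (\<tau> j)" if "j < Suc p" for j
        using that by (simp add: \<sigma>_eq front_cycle_def)
      have 2: "\<sigma> (Suc j) = Suc (\<tau> j)" if "Suc p \<le> j" for j
        using that by (simp add: \<sigma>_eq front_cycle_def)
      have "\<tau> j < \<tau> k" if "j < k" "k < Suc p" for j k
        using mono1[OF that] 1 that by simp
      moreover have "\<tau> j < \<tau> k" if "Suc p \<le> j" "j < k" "k < Suc (p + q)" for j k
        using mono2[of "Suc j" "Suc k"] 2 that by simp
      ultimately have "\<tau> \<in> unshuffles (Suc p) q"
        using \<tau>(1) by (simp add: unshuffles_def strict_mono_on_def)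
      with \<sigma>_eq show ?thesis by blast
    qed
  qed
qed

lemma finite_unshuffles: "finite (unshuffles p q)"
  by (rule finite_subset[OF _ finite_permutations[of "{..<p + q}"]]) (auto simp: unshuffles_def)


section \<open>The product of cochains as a recursion on the first bivector\<close>

section \<open>Insertion of cochains\<close>

text \<open>The interior product with the bivector \<open>A\<close>. It lowers the degree by one and
  kills cochains of degree \<open>0\<close>, since these vanish on nonempty lists.\<close>

definition contract :: "'v \<times> 'v \<Rightarrow> 'v cochain \<Rightarrow> 'v cochain" where
  "contract A f Bs = f (A # Bs)"

text \<open>Pullback along \<psi> in all arguments, leaving the target alone; equivariance of
  \<open>f\<close> under \<psi> says that \<psi> after \<open>f\<close> is
  \<open>twist \<psi> f\<close>.\<close>

definition twist :: "('v \<Rightarrow> 'v) \<Rightarrow> 'v cochain \<Rightarrow> 'v cochain" where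
  "twist \<psi> f As c = f (map (map_prod \<psi> \<psi>) As) (\<psi> c)"

lemma twist_twist: "twist \<phi> f (map (map_prod \<psi> \<psi>) As) (\<psi> c) = twist (\<phi> \<circ> \<psi>) f As c"
  by (simp add: twist_def map_prod.comp)

lemma contract_add: "contract A (f + g) = contract A f + contract A g"
  by (simp add: fun_eq_iff contract_def)

lemma contract_zero: "contract A 0 = 0"
  by (simp add: fun_eq_iff contract_def)

lemma contract_scale: "contract A (cochain_scale s r f) = cochain_scale s r (contract A f)"
  by (simp_all add: fun_eq_iff contract_def cochain_scale_def)

lemma cochain_scale_apply: "cochain_scale s r f As c = s r (f As c)"
  by (simp add: cochain_scale_def)

lemma twist_add: "twist \<psi> (f + g) = twist \<psi> f + twist \<psi> g"
  by (simp add: fun_eq_iff twist_def)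

lemma twist_scale: "twist \<psi> (cochain_scale s r f) = cochain_scale s r (twist \<psi> f)"
  by (simp add: fun_eq_iff twist_def cochain_scale_def)

lemma twist_comp: "twist \<psi> (twist \<phi> f) = twist (\<phi> \<circ> \<psi>) f"
  by (simp add: fun_eq_iff twist_def prod.map_comp map_prod.comp)

context hom_vector_space
begin

abbreviation lin :: "('v \<Rightarrow> 'v) \<Rightarrow> bool" where
  "lin \<equiv> Vector_Spaces.linear scale scale"

lemma lin_iff:
  fixes f :: "'v \<Rightarrow> 'v"
  shows "lin f \<longleftrightarrow> (\<forall>x y. f (x + y) = f x + f y) \<and> (\<forall>r x. f (scale r x) = scale r (f x))"
  by (simp add: Vector_Spaces.linear_iff vector_space_axioms)

text \<open>
  \<open>insertion \<psi> q f Q\<close> is \<open>f \<diamond> Q\<close> for \<open>Q\<close> of degree \<open>q\<close>, the twist \<open>\<alpha>\<^sup>q\<close> being replaced by an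
  arbitrary map \<open>\<psi>\<close>: contracting \<open>Q\<close> lowers \<open>q\<close> but must leave the twist unchanged.
\<close>

primrec insertion ::
    "('v \<Rightarrow> 'v) \<Rightarrow> nat \<Rightarrow> 'v cochain \<Rightarrow> 'v cochain \<Rightarrow> ('v \<times> 'v) list \<Rightarrow> 'v \<Rightarrow> 'v" where
  "insertion \<psi> q f Q [] c = (if q = 0 then f [] (Q [] c) else 0)"
| "insertion \<psi> q f Q (A # As) c =
     scale ((-1) ^ q) (insertion \<psi> q (contract (map_prod \<psi> \<psi> A) f) Q As c) +
     (if q = 0
      then twist \<psi> (contract (\<psi> (fst A), Q [] (snd A)) f) As c
         + twist \<psi> (contract (Q [] (fst A), \<psi> (snd A)) f) As c
      else insertion \<psi> (q - 1) f (contract A Q) As c)"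

text \<open>Slots are addressed by splitting the list and no length is fixed, so that the property
  passes to contractions.\<close>

definition alternating_multilinear :: "'v cochain \<Rightarrow> bool" where
  "alternating_multilinear f \<longleftrightarrow>
     (\<forall>As. lin (f As)) \<and>
     (\<forall>As Bs y c. lin (\<lambda>x. f (As @ (x, y) # Bs) c) \<and> lin (\<lambda>x. f (As @ (y, x) # Bs) c) \<and>
        f (As @ (y, y) # Bs) c = 0)"

lemma alternating_multilinear_contract:
  assumes "alternating_multilinear f"
  shows "alternating_multilinear (contract A f)"
proof -
  have "lin (f (A # As))" "lin (\<lambda>x. f ((A # As) @ (x, y) # Bs) c)"
    "lin (\<lambda>x. f ((A # As) @ (y, x) # Bs) c)" "f ((A # As) @ (y, y) # Bs) c = 0" for As Bs y c
    using assms unfolding alternating_multilinear_def by blast+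
  then show ?thesis
    unfolding alternating_multilinear_def contract_def by simp
qed

lemma cochain_add:
  assumes "alternating_multilinear f"
  shows "f As (x + y) = f As x + f As y"
    and "contract (x + y, z) f = contract (x, z) f + contract (y, z) f"
    and "contract (z, x + y) f = contract (z, x) f + contract (z, y) f"
proof -
  have "f ([] @ (x + y, z) # As) c = f ([] @ (x, z) # As) c + f ([] @ (y, z) # As) c"
    "f ([] @ (z, x + y) # As) c = f ([] @ (z, x) # As) c + f ([] @ (z, y) # As) c" for As c
    using assms unfolding alternating_multilinear_def lin_iff by blast+
  then show "contract (x + y, z) f = contract (x, z) f + contract (y, z) f"
    and "contract (z, x + y) f = contract (z, x) f + contract (z, y) f"
    by (simp_all add: fun_eq_iff contract_def)
qed (use assms in \<open>auto simp: alternating_multilinear_def lin_iff\<close>)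

lemma cochain_scale_arg:
  assumes "alternating_multilinear f"
  shows "f As (scale r x) = scale r (f As x)"
    and "contract (scale r x, z) f = cochain_scale scale r (contract (x, z) f)"
    and "contract (z, scale r x) f = cochain_scale scale r (contract (z, x) f)"
proof -
  have "f ([] @ (scale r x, z) # As) c = scale r (f ([] @ (x, z) # As) c)"
    "f ([] @ (z, scale r x) # As) c = scale r (f ([] @ (z, x) # As) c)" for As c
    using assms unfolding alternating_multilinear_def lin_iff by blast+
  then show "contract (scale r x, z) f = cochain_scale scale r (contract (x, z) f)"
    and "contract (z, scale r x) f = cochain_scale scale r (contract (z, x) f)"
    by (simp_all add: fun_eq_iff contract_def cochain_scale_def)
qed (use assms in \<open>auto simp: alternating_multilinear_def lin_iff\<close>)

text \<open>Polarisation: expand the vanishing contraction with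
  \<open>(x + y, x + y)\<close>.\<close>

lemma contract_skew:
  assumes "alternating_multilinear f"
  shows "contract (x, y) f = - contract (y, x) f"
proof -
  have "f ([] @ (z, z) # As) c = 0" for z As c
    using assms unfolding alternating_multilinear_def by blast
  then have "contract (z, z) f = 0" for z
    by (simp add: fun_eq_iff contract_def)
  from this[of "x + y"] this[of x] this[of y] show ?thesis
    by (simp add: cochain_add[OF assms] eq_neg_iff_add_eq_0 add.commute)
qed

lemma insertion_add_left:
  "insertion \<psi> q (f + g) Q As c = insertion \<psi> q f Q As c + insertion \<psi> q g Q As c"
  by (induction As arbitrary: q f g Q c)
    (simp_all add: contract_add twist_def scale_right_distrib ac_simps)

lemma insertion_scale_left:
  "insertion \<psi> q (cochain_scale scale r f) Q As c = scale r (insertion \<psi> q f Q As c)"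
  by (induction As arbitrary: q f Q c)
    (simp_all add: contract_scale scale_right_distrib scale_left_commute, simp_all add: cochain_scale_def twist_def
        scale_right_distrib)

lemma insertion_zero_left: "insertion \<psi> q 0 Q As c = 0"
  by (induction As arbitrary: q Q c) (simp_all add: contract_zero twist_def)

lemma insertion_add_right:
  assumes "alternating_multilinear f"
  shows "insertion \<psi> q f (Q + R) As c = insertion \<psi> q f Q As c + insertion \<psi> q f R As c"
  using assms
  by (induction As arbitrary: q f Q R c)
    (simp_all add: contract_add twist_def scale_right_distrib ac_simps cochain_add
      alternating_multilinear_contract)

lemma insertion_scale_right:
  assumes "alternating_multilinear f"
  shows "insertion \<psi> q f (cochain_scale scale r Q) As c = scale r (insertion \<psi> q f Q As c)"
  using assms
proof (induction As arbitrary: q f Q c)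
  case Nil
  then show ?case by (simp add: cochain_scale_def cochain_scale_arg)
next
  case (Cons A As)
  then have "twist \<psi> (contract (x, cochain_scale scale r Q [] y) f) As c =
     scale r (twist \<psi> (contract (x, Q [] y) f) As c)"
    "twist \<psi> (contract (cochain_scale scale r Q [] y, x) f) As c =
     scale r (twist \<psi> (contract (Q [] y, x) f) As c)" for x y
    using Cons.prems by (simp_all add: cochain_scale_def cochain_scale_arg twist_def)
  with Cons show ?case
    by (simp add: contract_scale alternating_multilinear_contract scale_right_distrib scale_left_commute)
qed

lemma insertion_zero_right:
  assumes "alternating_multilinear f"
  shows "insertion \<psi> q f 0 As c = 0"
  using insertion_scale_right[OF assms, of \<psi> q 0 0 As c] by (simp add: cochain_scale_def zero_fun_def)

text \<open>The maps \<rho> on values and \<theta> on arguments are kept apart to serve two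
  purposes: both equal to \<alpha> gives equivariance of the product, and \<rho> the identity moves
  a \<open>twist\<close> through it. The primed cochains absorb contractions, where \<open>A\<close>
  becomes its image under \<theta>.\<close>

lemma insertion_natural:
  assumes "lin \<rho>"
    and "\<And>x. \<theta> (\<psi> x) = \<psi> (\<theta> x)"
    and "\<And>As c. \<rho> (f As c) = f' (map (map_prod \<theta> \<theta>) As) (\<theta> c)"
    and "\<And>As c. \<theta> (Q As c) = Q' (map (map_prod \<theta> \<theta>) As) (\<theta> c)"
  shows "\<rho> (insertion \<psi> q f Q As c) = insertion \<psi> q f' Q' (map (map_prod \<theta> \<theta>) As) (\<theta> c)"
  using assms(3,4)
proof (induction As arbitrary: q f f' Q Q')
  case Nil
  with assms(1) show ?case
    by (auto simp: lin_iff) (metis scale_zero_left)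
next
  case (Cons A As)
  have *: "\<rho> (insertion \<psi> q (contract (map_prod \<psi> \<psi> A) f) Q As c) =
     insertion \<psi> q (contract (map_prod \<psi> \<psi> (map_prod \<theta> \<theta> A)) f') Q' (map (map_prod \<theta> \<theta>) As) (\<theta> c)" for q
    by (rule Cons.IH)
       (simp_all add: contract_def Cons.prems assms(2) map_prod_def split: prod.splits)
  have **: "\<rho> (insertion \<psi> q f (contract A Q) As c) =
     insertion \<psi> q f' (contract (map_prod \<theta> \<theta> A) Q') (map (map_prod \<theta> \<theta>) As) (\<theta> c)" for q
    by (rule Cons.IH) (simp_all add: contract_def Cons.prems)
  have Q0: "Q' [] (\<theta> x) = \<theta> (Q [] x)" for x using Cons.prems(2)[of "[]" x] by simp
  have comm: "map_prod \<psi> \<psi> \<circ> map_prod \<theta> \<theta> = map_prod \<theta> \<theta> \<circ> map_prod \<psi> \<psi>"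
    by (auto simp: assms(2))
  show ?case using assms(1)
    by (simp add: * ** twist_def lin_iff) (simp add: contract_def Cons.prems(1) Q0 comm flip: assms(2))
qed

text \<open>Complements \<open>insertion_natural\<close> where \<open>Q\<close> has no intertwining
  companion: the pullback is absorbed into the twist of the insertion and into
  \<open>Q\<close>.\<close>

lemma insertion_twist:
  "insertion \<phi> q f Q (map (map_prod \<psi> \<psi>) As) (\<psi> c) = insertion (\<phi> \<circ> \<psi>) q f (twist \<psi> Q) As c"
proof (induction As arbitrary: q f Q)
  case (Cons A As)
  have "twist \<psi> (contract (map_prod \<psi> \<psi> A) Q) = contract A (twist \<psi> Q)"
    by (simp add: fun_eq_iff twist_def contract_def)
  with Cons show ?case
    by (cases A) (simp add: twist_twist, simp add: twist_def comp_def)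
qed (simp add: twist_def)


section \<open>Graded symmetry of the associator\<close>

subsection \<open>The pre-Lie identity\<close>

text \<open>The recursion as an equation between cochains, so that it also unfolds an insertion
  nested inside another.\<close>

lemma contract_insertion:
  "contract A (insertion \<psi> q f Q) =
     cochain_scale scale ((-1) ^ q) (insertion \<psi> q (contract (map_prod \<psi> \<psi> A) f) Q) +
     (if q = 0
      then twist \<psi> (contract (\<psi> (fst A), Q [] (snd A)) f)
         + twist \<psi> (contract (Q [] (fst A), \<psi> (snd A)) f)
      else insertion \<psi> (q - 1) f (contract A Q))"
  by (simp add: fun_eq_iff cochain_scale_def contract_def[of A "insertion \<psi> q f Q"])

text \<open>
  For equivariant cochains take \<open>Q' = Q\<close> and \<open>R' = R\<close>. The vanishing conditions are needed because
  contracting a cochain of degree \<open>0\<close> has to give \<open>0\<close>.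
\<close>

lemma insertion_pre_Lie:
  assumes \<chi>: "\<chi> = \<phi> \<circ> \<psi>"
    and comm: "\<And>x. \<psi> (\<phi> x) = \<phi> (\<psi> x)"
    and "alternating_multilinear f"
    and "\<And>As c. \<psi> (Q As c) = Q' (map (map_prod \<psi> \<psi>) As) (\<psi> c)"
    and "\<And>As c. \<phi> (R As c) = R' (map (map_prod \<phi> \<phi>) As) (\<phi> c)"
    and "\<And>As c. length As \<noteq> q \<Longrightarrow> Q' As c = 0"
    and "\<And>As c. length As \<noteq> r \<Longrightarrow> R' As c = 0"
  shows "insertion \<psi> r (insertion \<phi> q f Q') R As c -
      insertion \<chi> (q + r) f (insertion \<psi> r Q' R) As c =
    scale ((-1) ^ (q * r)) (insertion \<phi> q (insertion \<psi> r f R') Q As c -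
      insertion \<chi> (q + r) f (insertion \<phi> q R' Q) As c)"
  using assms(3-)
proof (induction As arbitrary: q r f Q Q' R R')
  case Nil
  note Nil(2)[of "[]", simp] Nil(3)[of "[]", simp]
  then show ?case by auto
next
  case (Cons A As)
  obtain a b where A: "A = (a, b)" by fastforce
  have \<chi>': "\<psi> \<circ> \<phi> = \<chi>" by (simp add: fun_eq_iff comm \<chi>)
  have \<chi>_apply: "\<chi> a = \<phi> (\<psi> a)" "\<chi> b = \<phi> (\<psi> b)" by (simp_all add: \<chi>)
  have lin_id: "lin id" by (simp add: lin_iff)
  \<comment> \<open>Pulling back along \<psi> turns the companion \<open>Q'\<close> into
    \<open>Q\<close>, and likewise along \<phi> for \<open>R'\<close>; this is what the intertwining
    conditions are for.\<close>
  have t1: "twist \<psi> (insertion \<phi> q g Q') = insertion \<phi> q (twist \<psi> g) Q" for q g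
    using insertion_natural[of id \<psi> \<phi> "twist \<psi> g" g Q Q'] Cons.prems(2) comm lin_id
    by (simp add: fun_eq_iff twist_def)
  have t2: "twist \<phi> (insertion \<psi> q g R') = insertion \<psi> q (twist \<phi> g) R" for q g
    using insertion_natural[of id \<phi> \<psi> "twist \<phi> g" g R R'] Cons.prems(3) comm lin_id
    by (simp add: fun_eq_iff twist_def)
  \<comment> \<open>A companion contracted with an arbitrary \<open>y\<close> need not be
    intertwined with anything, so here the pullback is absorbed, changing the twist to
    \<chi>.\<close>
  have t3: "twist \<psi> (insertion \<phi> q g (contract y Q')) = insertion \<chi> q g (twist \<psi> (contract y Q'))" for q g y
    by (simp add: fun_eq_iff insertion_twist \<chi> twist_def[of \<psi> "insertion \<phi> q g (contract y Q')"])
  have t4: "twist \<phi> (insertion \<psi> q g (contract y R')) = insertion \<chi> q g (twist \<phi> (contract y R'))" for q g y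
    by (simp add: fun_eq_iff insertion_twist twist_def[of \<phi> "insertion \<psi> q g (contract y R')"] \<chi>')
  have Q0: "Q' [] (\<psi> x) = \<psi> (Q [] x)" and R0: "R' [] (\<phi> x) = \<phi> (R [] x)" for x
    using Cons.prems(2,3)[of "[]" x] by simp_all
  \<comment> \<open>The hypotheses \<open>IH1\<close>, \<open>IH2\<close> and \<open>IH3\<close>
    treat the terms in which \<open>A\<close> enters \<open>f\<close>, \<open>Q\<close> and
    \<open>R\<close>; in the last two the companion is contracted with the image of
    \<open>A\<close>.\<close>
  have IH1: "insertion \<psi> r (insertion \<phi> q (contract (\<phi> (\<psi> a), \<phi> (\<psi> b)) f) Q') R As c =
      insertion \<chi> (q + r) (contract (\<phi> (\<psi> a), \<phi> (\<psi> b)) f) (insertion \<psi> r Q' R) As c +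
    scale ((-1) ^ (q * r)) (insertion \<phi> q (insertion \<psi> r (contract (\<phi> (\<psi> a), \<phi> (\<psi> b)) f) R') Q As c -
      insertion \<chi> (q + r) (contract (\<phi> (\<psi> a), \<phi> (\<psi> b)) f) (insertion \<phi> q R' Q) As c)"
    using Cons.IH[OF alternating_multilinear_contract[OF Cons.prems(1)], of Q Q' R R' q r] Cons.prems(2,3,4,5)
    by (simp add: diff_eq_eq add.commute)
  have cQ: "\<psi> (contract (a, b) Q As c) = contract (\<psi> a, \<psi> b) Q' (map (map_prod \<psi> \<psi>) As) (\<psi> c)"
    and cR: "\<phi> (contract (a, b) R As c) = contract (\<phi> a, \<phi> b) R' (map (map_prod \<phi> \<phi>) As) (\<phi> c)"
    for As c
    by (simp_all add: contract_def Cons.prems(2,3))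
  have vQ: "contract y Q' As c = 0" if "q = Suc q1" "length As \<noteq> q1" for q1 y As c
    using that by (simp add: contract_def Cons.prems(4))
  have vR: "contract y R' As c = 0" if "r = Suc r1" "length As \<noteq> r1" for r1 y As c
    using that by (simp add: contract_def Cons.prems(5))
  have zQ: "contract y Q' = 0" if "q = 0" for y
    using that by (simp add: fun_eq_iff contract_def Cons.prems(4))
  have zR: "contract y R' = 0" if "r = 0" for y
    using that by (simp add: fun_eq_iff contract_def Cons.prems(5))
  have z: "insertion \<rho> n 0 S = 0" for \<rho> n S
    by (simp add: fun_eq_iff insertion_zero_left)
  have IH2: "insertion \<psi> r (insertion \<phi> q1 f (contract (\<psi> a, \<psi> b) Q')) R As c =
      insertion \<chi> (q1 + r) f (insertion \<psi> r (contract (\<psi> a, \<psi> b) Q') R) As c +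
    scale ((-1) ^ (q1 * r)) (insertion \<phi> q1 (insertion \<psi> r f R') (contract (a, b) Q) As c -
      insertion \<chi> (q1 + r) f (insertion \<phi> q1 R' (contract (a, b) Q)) As c)" if "q = Suc q1" for q1
    using Cons.IH[OF Cons.prems(1), of "contract (a, b) Q" "contract (\<psi> a, \<psi> b) Q'" R R' q1 r] cQ Cons.prems(3,5) vQ[OF that] 
    by (simp add: diff_eq_eq add.commute)
  have IH3: "insertion \<psi> r1 (insertion \<phi> q f Q') (contract (a, b) R) As c =
      insertion \<chi> (q + r1) f (insertion \<psi> r1 Q' (contract (a, b) R)) As c +
    scale ((-1) ^ (q * r1)) (insertion \<phi> q (insertion \<psi> r1 f (contract (\<phi> a, \<phi> b) R')) Q As c -
      insertion \<chi> (q + r1) f (insertion \<phi> q (contract (\<phi> a, \<phi> b) R') Q) As c)" if "r = Suc r1" for r1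
    using Cons.IH[OF Cons.prems(1), of Q Q' "contract (a, b) R" "contract (\<phi> a, \<phi> b) R'" q r1] Cons.prems(2,4) cR vR[OF that]
    by (simp add: diff_eq_eq add.commute)
  note expand = contract_insertion insertion_add_left insertion_scale_left
    insertion_add_right[OF Cons.prems(1)] insertion_scale_right[OF Cons.prems(1)]
    twist_add twist_scale twist_comp
    comm \<chi>[symmetric] \<chi>' \<chi>_apply Q0 R0 zQ zR z insertion_zero_right[OF Cons.prems(1)]
  \<comment> \<open>A zero degree replaces a contraction by derivation terms, which
    \<open>t1\<close> to \<open>t4\<close> bring to a common form; with both degrees positive the
    induction hypotheses suffice. Parities settle the signs.\<close>
  note dist = scale_right_distrib scale_right_diff_distrib cochain_scale_apply algebra_simps
  show ?case
  proof (cases q; cases r)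
    assume "q = 0" "r = 0"
    then show ?thesis
      using IH1 by (simp add: A expand t1 t2 dist)
  next
    fix r' assume "q = 0" "r = Suc r'"
    then show ?thesis
      using IH1 IH3[of r'] by (cases "even r'") (simp_all add: A expand t2 t4 dist)
  next
    fix q' assume "q = Suc q'" "r = 0"
    then show ?thesis
      using IH1 IH2[of q'] by (cases "even q'") (simp_all add: A expand t1 t3 dist)
  next
    fix q' r' assume q: "q = Suc q'" and r: "r = Suc r'"
    note IH = IH1[unfolded q r] IH2[OF q, unfolded r] IH3[OF r, unfolded q]
    show ?thesis
      unfolding q r
      by (cases "even q'"; cases "even r'") (simp_all add: A expand dist q r IH)
  qed
qed


section \<open>The recursion computes the signed sums over unshuffles\<close>

subsection \<open>Comparison with sums over unshuffles\<close>

text \<open>The signed sum over all splittings of the first \<open>p + q\<close> entries into two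
  subsequences. Abstracting the summand to \<open>F\<close> lets one recursion serve all sums in the
  product.\<close>

definition unshuffle_sum ::
    "nat \<Rightarrow> nat \<Rightarrow> (('v \<times> 'v) list \<Rightarrow> ('v \<times> 'v) list \<Rightarrow> 'v) \<Rightarrow> ('v \<times> 'v) list \<Rightarrow> 'v" where
  "unshuffle_sum p q F As =
     (\<Sum>\<sigma>\<in>unshuffles p q. scale (of_int (sign \<sigma>))
        (F (map (\<lambda>i. As ! \<sigma> i) [0..<p]) (map (\<lambda>i. As ! \<sigma> i) [p..<p + q])))"

lemma map_nth_upt: "n \<le> length xs \<Longrightarrow> map (\<lambda>i. xs ! i) [0..<n] = take n xs"
  by (rule nth_equalityI) auto

lemma unshuffle_sum_0_left: "q \<le> length As \<Longrightarrow> unshuffle_sum 0 q F As = F [] (take q As)"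
  by (simp add: unshuffle_sum_def unshuffles_0_left map_nth_upt del: upt_Suc)

lemma unshuffle_sum_0_right: "p \<le> length As \<Longrightarrow> unshuffle_sum p 0 F As = F (take p As) []"
  by (simp add: unshuffle_sum_def unshuffles_0_right map_nth_upt del: upt_Suc)

lemma map_upt_Suc_Suc: "map f [Suc m..<Suc n] = map (\<lambda>i. f (Suc i)) [m..<n]"
  by (simp only: map_Suc_upt[symmetric] map_map comp_def)

text \<open>Follows from \<open>unshuffles_Suc_Suc\<close>; the sign of the second part is that of
  the cycle, since \<open>A\<close> has to pass all \<open>Suc p\<close> entries of the first
  block.\<close>

lemma unshuffle_sum_Cons:
  "unshuffle_sum (Suc p) (Suc q) F (A # As) =
     unshuffle_sum p (Suc q) (\<lambda>Xs Ys. F (A # Xs) Ys) As +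
     scale ((-1) ^ Suc p) (unshuffle_sum (Suc p) q (\<lambda>Xs Ys. F Xs (A # Ys)) As)"
proof -
  let ?c = "front_cycle (Suc p)"
  let ?G = "\<lambda>\<sigma>. scale (of_int (sign \<sigma>))
    (F (map (\<lambda>i. (A # As) ! \<sigma> i) [0..<Suc p]) (map (\<lambda>i. (A # As) ! \<sigma> i) [Suc p..<Suc p + Suc q]))"
  have c: "?c permutes {..<Suc (Suc (p + q))}" by (rule front_cycle_permutes) simp
  have inj1: "inj_on perm_lift (unshuffles p (Suc q))"
    by (simp add: inj_on_def perm_lift_inject)
  have inj2: "inj_on (\<lambda>\<tau>. perm_lift \<tau> \<circ> ?c) (unshuffles (Suc p) q)"
  proof (rule inj_onI)
    fix \<sigma> \<tau> assume eq: "perm_lift \<sigma> \<circ> ?c = perm_lift \<tau> \<circ> ?c"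
    have "perm_lift \<sigma> i = perm_lift \<tau> i" for i
      using fun_cong[OF eq, of "inv ?c i"] permutes_inverses(1)[OF c, of i] by simp
    then have "perm_lift \<sigma> = perm_lift \<tau>" by (rule ext)
    then show "\<sigma> = \<tau>" by (simp only: perm_lift_inject)
  qed
  have "(perm_lift \<tau> \<circ> ?c) 0 \<noteq> 0" for \<tau>
    by (simp add: front_cycle_def)
  then have "perm_lift \<sigma> \<noteq> perm_lift \<tau> \<circ> ?c" for \<sigma> \<tau>
    by (metis perm_lift_simps(1))
  then have disj: "perm_lift ` unshuffles p (Suc q) \<inter> (\<lambda>\<tau>. perm_lift \<tau> \<circ> ?c) ` unshuffles (Suc p) q = {}"
    by blast
  have "?G (perm_lift \<tau>) = scale (of_int (sign \<tau>))
      (F (A # map (\<lambda>i. As ! \<tau> i) [0..<p]) (map (\<lambda>i. As ! \<tau> i) [p..<p + Suc q]))"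
    if "\<tau> \<in> unshuffles p (Suc q)" for \<tau>
  proof -
    have "sign (perm_lift \<tau>) = sign \<tau>"
      using that by (intro sign_perm_lift[of _ "p + Suc q"]) (simp add: unshuffles_def)
    then show ?thesis
      by (simp add: upt_conv_Cons map_upt_Suc_Suc del: upt_Suc)
  qed
  moreover have "?G (perm_lift \<tau> \<circ> ?c) = scale ((-1) ^ Suc p) (scale (of_int (sign \<tau>))
      (F (map (\<lambda>i. As ! \<tau> i) [0..<Suc p]) (A # map (\<lambda>i. As ! \<tau> i) [Suc p..<Suc p + q])))"
    if "\<tau> \<in> unshuffles (Suc p) q" for \<tau>
  proof -
    have \<tau>: "\<tau> permutes {..<Suc p + q}" using that by (simp add: unshuffles_def)
    have "permutation (perm_lift \<tau>)" "permutation ?c"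
      using perm_lift_permutes[OF \<tau>] c by (auto simp: permutation_permutes)
    then have "sign (perm_lift \<tau> \<circ> ?c) = (-1) ^ Suc p * sign \<tau>"
      by (simp only: sign_compose sign_front_cycle sign_perm_lift[OF \<tau>] mult.commute)
    moreover have "map (\<lambda>i. (A # As) ! (perm_lift \<tau> \<circ> ?c) i) [0..<Suc p] = map (\<lambda>i. As ! \<tau> i) [0..<Suc p]"
      by (rule map_cong) (auto simp: front_cycle_def)
    \<comment> \<open>The second block starts at \<open>Suc p\<close>, which the cycle sends to
      \<open>0\<close>, the position of \<open>A\<close>; the later positions are fixed by the cycle
      and shifted by the lift.\<close>
    moreover have "map (\<lambda>i. (A # As) ! (perm_lift \<tau> \<circ> ?c) i) [Suc p..<Suc p + Suc q] =
        A # map (\<lambda>i. As ! \<tau> i) [Suc p..<Suc p + q]"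
    proof -
      have "[Suc p..<Suc p + Suc q] = Suc p # map Suc [Suc p..<Suc p + q]"
        unfolding map_Suc_upt by (simp add: upt_conv_Cons del: upt_Suc)
      then show ?thesis by (auto simp: front_cycle_def)
    qed
    ultimately show ?thesis by (simp only: scale_scale of_int_mult of_int_power of_int_minus of_int_1)
  qed
  ultimately show ?thesis
    unfolding unshuffle_sum_def unshuffles_Suc_Suc scale_sum_right
    by (subst sum.union_disjoint)
       (simp_all only: finite_imageI finite_unshuffles disj sum.reindex[OF inj1] sum.reindex[OF inj2] comp_apply
         cong: sum.cong)
qed

text \<open>Induction on the list: splittings with \<open>A\<close> in the first block give the
  contraction of \<open>P\<close>, those with \<open>A\<close> in the second the contraction of
  \<open>Q\<close>. For \<open>q = 0\<close> the summand \<open>k = 0\<close> consists of the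
  derivation terms at \<open>A\<close>.\<close>

lemma insertion_eq_unshuffle_sums:
  assumes "length As = p + q" "\<And>Bs c. length Bs \<noteq> p \<Longrightarrow> P Bs c = 0"
  shows "insertion \<psi> q P Q As c =
    scale ((-1) ^ (p * q)) (unshuffle_sum p q (\<lambda>Xs Ys. P (map (map_prod \<psi> \<psi>) Xs) (Q Ys c)) As) +
    (\<Sum>k<p. scale ((-1) ^ (k * q)) (unshuffle_sum k q (\<lambda>Xs Ys.
       P (map (map_prod \<psi> \<psi>) Xs @
          (\<psi> (fst (As ! (k + q))), Q Ys (snd (As ! (k + q)))) # map (map_prod \<psi> \<psi>) (drop (k + q + 1) As)) (\<psi> c) +
       P (map (map_prod \<psi> \<psi>) Xs @
          (Q Ys (fst (As ! (k + q))), \<psi> (snd (As ! (k + q)))) # map (map_prod \<psi> \<psi>) (drop (k + q + 1) As)) (\<psi> c)) As))"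
  using assms
proof (induction As arbitrary: p q P Q)
  case Nil
  then show ?case by (simp add: unshuffle_sum_0_left)
next
  case (Cons A As)
  let ?C = "contract (map_prod \<psi> \<psi> A) P"
  have vC: "?C Bs d = 0" if "p = Suc p'" "length Bs \<noteq> p'" for p' Bs d
    using that by (simp add: contract_def Cons.prems(2))
  show ?case
  proof (cases q)
    case q: 0
    with Cons.prems(1) obtain p' where p: "p = Suc p'" by auto
    have C: "insertion \<psi> 0 ?C Q As c = unshuffle_sum p' 0 (\<lambda>Xs Ys. ?C (map (map_prod \<psi> \<psi>) Xs) (Q Ys c)) As +
      (\<Sum>k<p'. (unshuffle_sum k 0 (\<lambda>Xs Ys.
       ?C (map (map_prod \<psi> \<psi>) Xs @
          (\<psi> (fst (As ! k)), Q Ys (snd (As ! k))) # map (map_prod \<psi> \<psi>) (drop (k + 1) As)) (\<psi> c) +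
       ?C (map (map_prod \<psi> \<psi>) Xs @
          (Q Ys (fst (As ! k)), \<psi> (snd (As ! k))) # map (map_prod \<psi> \<psi>) (drop (k + 1) As)) (\<psi> c)) As))"
      using Cons.IH[of p' 0 ?C Q] Cons.prems(1) vC[OF p] p q by simp
    show ?thesis
      using Cons.prems(1)
      by (simp add: C q p sum.lessThan_Suc_shift unshuffle_sum_0_right contract_def twist_def ac_simps
          del: sum.lessThan_Suc)
  next
    case q: (Suc q')
    let ?D = "contract A Q"
    have D: "insertion \<psi> q' P ?D As c =
      scale ((-1) ^ (p * q')) (unshuffle_sum p q' (\<lambda>Xs Ys. P (map (map_prod \<psi> \<psi>) Xs) (?D Ys c)) As) +
      (\<Sum>k<p. scale ((-1) ^ (k * q')) (unshuffle_sum k q' (\<lambda>Xs Ys.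
       P (map (map_prod \<psi> \<psi>) Xs @
          (\<psi> (fst (As ! (k + q'))), ?D Ys (snd (As ! (k + q')))) # map (map_prod \<psi> \<psi>) (drop (k + q' + 1) As)) (\<psi> c) +
       P (map (map_prod \<psi> \<psi>) Xs @
          (?D Ys (fst (As ! (k + q'))), \<psi> (snd (As ! (k + q')))) # map (map_prod \<psi> \<psi>) (drop (k + q' + 1) As)) (\<psi> c)) As))"
      using Cons.IH[of p q' P ?D] Cons.prems by (simp add: q)
    \<comment> \<open>Here \<open>x\<close> collects the splittings with \<open>A\<close> before the
      distinguished bivector, and \<open>y\<close> those with \<open>A\<close> inside
      \<open>Q\<close>.\<close>
    have signs: "scale ((-1) ^ (Suc k * Suc q')) (x + scale ((-1) ^ Suc k) y) =
        scale ((-1) ^ Suc q') (scale ((-1) ^ (k * Suc q')) x) + scale ((-1) ^ (Suc k * q')) y" for k x y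
      by (cases "even k"; cases "even q'") (simp_all add: scale_right_distrib)
    show ?thesis
    proof (cases p)
      case p: 0
      have "?C = 0" using Cons.prems(2) by (simp add: p fun_eq_iff contract_def)
      then show ?thesis
        using Cons.prems(1) by (simp add: D p q contract_def insertion_zero_left unshuffle_sum_0_left)
    next
      case p: (Suc p')
      have C: "insertion \<psi> q ?C Q As c =
        scale ((-1) ^ (p' * q)) (unshuffle_sum p' q (\<lambda>Xs Ys. ?C (map (map_prod \<psi> \<psi>) Xs) (Q Ys c)) As) +
        (\<Sum>k<p'. scale ((-1) ^ (k * q)) (unshuffle_sum k q (\<lambda>Xs Ys.
         ?C (map (map_prod \<psi> \<psi>) Xs @
            (\<psi> (fst (As ! (k + q))), Q Ys (snd (As ! (k + q)))) # map (map_prod \<psi> \<psi>) (drop (k + q + 1) As)) (\<psi> c) +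
         ?C (map (map_prod \<psi> \<psi>) Xs @
            (Q Ys (fst (As ! (k + q))), \<psi> (snd (As ! (k + q)))) # map (map_prod \<psi> \<psi>) (drop (k + q + 1) As)) (\<psi> c)) As))"
        using Cons.IH[of p' q ?C Q] Cons.prems(1) vC[OF p] by (simp add: p)
      \<comment> \<open>In the summand \<open>k = 0\<close> nothing precedes the distinguished
        bivector, so \<open>A\<close> can only enter \<open>Q\<close>; it is split off, and the
        others follow \<open>unshuffle_sum_Cons\<close>.\<close>
      show ?thesis
        using Cons.prems(1)
        by (simp add: C[unfolded q] D p q contract_def sum.lessThan_Suc_shift unshuffle_sum_Cons unshuffle_sum_0_left
            signs sum.distrib del: sum.lessThan_Suc power_Suc mult_Suc mult_Suc_right)
           (simp add: scale_right_distrib scale_sum_right ac_simps del: power_Suc mult_Suc mult_Suc_right)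
    qed
  qed
qed

text \<open>The recursion always feeds exactly \<open>q\<close> bivectors to \<open>Q\<close>, so
  the total length is governed by where \<open>P\<close> vanishes.\<close>

lemma insertion_vanishes:
  assumes "\<And>Bs c. length Bs \<noteq> p \<Longrightarrow> P Bs c = 0" "length As \<noteq> p + q"
  shows "insertion \<psi> q P Q As c = 0"
  using assms
proof (induction As arbitrary: p q P Q)
  case (Cons A As)
  have C: "insertion \<psi> q (contract B P) Q As c = 0" for B
  proof (cases p)
    case 0
    then have "contract B P = 0" using Cons.prems(1) by (simp add: fun_eq_iff contract_def)
    then show ?thesis by (simp add: insertion_zero_left)
  next
    case (Suc p')
    then show ?thesis
      using Cons.prems by (intro Cons.IH[of p']) (auto simp: contract_def)
  qed
  show ?case
  proof (cases q)
    case 0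
    then show ?thesis
      using C Cons.prems by (simp add: twist_def contract_def[of _ P "map _ _"])
  next
    case (Suc q')
    then show ?thesis
      using C Cons.IH[of p P q'] Cons.prems by simp
  qed
next
  case Nil
  then show ?case by (cases "q = 0") auto
qed

text \<open>From here on the product is handled through the recursion alone.\<close>

lemma hlts_circ_eq_insertion:
  assumes "\<And>Bs c. length Bs \<noteq> p \<Longrightarrow> P Bs c = 0"
  shows "hlts_circ scale \<alpha> p q P Q = insertion (\<alpha> ^^ q) q P Q"
proof (intro ext)
  fix As c
  show "hlts_circ scale \<alpha> p q P Q As c = insertion (\<alpha> ^^ q) q P Q As c"
  proof (cases "length As = p + q")
    case True
    let ?\<psi> = "\<alpha> ^^ q"
    have "map (\<lambda>i. map_prod ?\<psi> ?\<psi> (As ! i)) [k + q + 1..<p + q] = map (map_prod ?\<psi> ?\<psi>) (drop (k + q + 1) As)" for k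
      using True by (intro nth_equalityI) auto
    then show ?thesis
      using True
      by (subst insertion_eq_unshuffle_sums[OF True], use assms in blast)
         (simp add: hlts_circ_def Let_def unshuffle_sum_def scale_sum_right split_beta comp_def)
  next
    case False
    then show ?thesis by (simp add: hlts_circ_def insertion_vanishes[OF assms])
  qed
qed


section \<open>Closure of the cochain spaces and the graded Lie axioms\<close>

subsection \<open>The graded Lie algebra\<close>

lemma lin_add: "lin f \<Longrightarrow> lin g \<Longrightarrow> lin (\<lambda>x. f x + g x)"
  by (simp add: lin_iff scale_right_distrib)

lemma lin_scale: "lin f \<Longrightarrow> lin (\<lambda>x. scale r (f x))"
  by (simp add: lin_iff scale_right_distrib scale_left_commute)

lemma lin_zero: "lin (\<lambda>x. 0)"
  by (simp add: lin_iff)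

lemma lin_comp: "lin f \<Longrightarrow> lin g \<Longrightarrow> lin (\<lambda>x. f (g x))"
  by (simp add: lin_iff)

lemma lin_zero_arg: "lin f \<Longrightarrow> f 0 = 0"
  by (metis lin_iff scale_zero_left)

lemma lin_twist: "lin \<alpha>" by (rule linear_twist)

lemma lin_twist_power: "lin (\<alpha> ^^ n)"
  by (induction n) (use lin_twist in \<open>simp_all add: lin_iff\<close>)

lemma alternating_multilinearD:
  assumes "alternating_multilinear f"
  shows "lin (f As)" "lin (\<lambda>x. f (As @ (x, y) # Bs) c)" "lin (\<lambda>x. f (As @ (y, x) # Bs) c)"
    "f (As @ (y, y) # Bs) c = 0"
  using assms unfolding alternating_multilinear_def by blast+

lemma lin_insertion:
  assumes "lin \<psi>" "alternating_multilinear f" "alternating_multilinear Q"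
  shows "lin (insertion \<psi> q f Q As)"
  using assms(2,3)
proof (induction As arbitrary: q f Q)
  case Nil
  show ?case
    using lin_comp[OF alternating_multilinearD(1)[OF Nil(1)] alternating_multilinearD(1)[OF Nil(2)]] lin_zero
    by (cases "q = 0") simp_all
next
  case (Cons A As)
  note c = alternating_multilinear_contract
  have "lin (\<lambda>c. twist \<psi> (contract B f) As c)" for B
    using lin_comp[OF alternating_multilinearD(1)[OF c[OF Cons.prems(1), of B]] assms(1)] by (simp add: twist_def)
  then show ?case
    using Cons.IH[OF c[OF Cons.prems(1)] Cons.prems(2)] Cons.IH[OF Cons.prems(1) c[OF Cons.prems(2)]]
    by (cases "q = 0") (simp_all add: lin_add lin_scale)
qed

text \<open>Induction on the prefix \<open>As\<close>. In the base case the slot is the first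
  bivector and the recursion exposes it; otherwise contraction passes to a shorter prefix.\<close>

lemma insertion_slot:
  assumes "lin \<psi>" "alternating_multilinear f" "alternating_multilinear Q"
  shows "lin (\<lambda>x. insertion \<psi> q f Q (As @ (x, y) # Bs) c) \<and>
    lin (\<lambda>x. insertion \<psi> q f Q (As @ (y, x) # Bs) c) \<and>
    insertion \<psi> q f Q (As @ (y, y) # Bs) c = 0"
  using assms(2,3)
proof (induction As arbitrary: q f Q)
  case Nil
  note f = Nil(1) and Q = Nil(2)
  have \<psi>: "\<psi> (u + v) = \<psi> u + \<psi> v" "\<psi> (scale r u) = scale r (\<psi> u)" for u v r
    using assms(1) by (simp_all add: lin_iff)
  have zero: "contract (u, u) g = 0" if "alternating_multilinear g" for u g
    using alternating_multilinearD(4)[OF that, of "[]"] by (simp add: fun_eq_iff contract_def)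
  \<comment> \<open>At a pair \<open>(y, y)\<close> in degree \<open>0\<close> the two derivation
    terms cancel by skewness of \<open>f\<close>.\<close>
  have skew: "contract (u, v) f Ds d + contract (v, u) f Ds d = 0" for u v Ds d
    by (subst contract_skew[OF f]) simp
  have scl: "cochain_scale scale r g Bs c = scale r (g Bs c)" for r g Bs c
    by (simp add: cochain_scale_def)
  show ?case
    unfolding lin_iff
    by (auto simp: \<psi> cochain_add[OF f] cochain_add[OF Q] cochain_scale_arg[OF f] cochain_scale_arg[OF Q]
        insertion_add_left insertion_scale_left insertion_add_right[OF f] insertion_scale_right[OF f]
        zero[OF f] zero[OF Q] insertion_zero_left insertion_zero_right[OF f] skew
        twist_def scl scale_right_distrib ac_simps)
next
  case (Cons A As)
  note c = alternating_multilinear_contract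
  have "lin (\<lambda>x. twist \<psi> (contract B f) (As @ (x, y) # Bs) c)"
     "lin (\<lambda>x. twist \<psi> (contract B f) (As @ (y, x) # Bs) c)"
     "twist \<psi> (contract B f) (As @ (y, y) # Bs) c = 0" for B
    using lin_comp[OF alternating_multilinearD(2)[OF c[OF Cons.prems(1), of B]] assms(1)]
       lin_comp[OF alternating_multilinearD(3)[OF c[OF Cons.prems(1), of B]] assms(1)]
       alternating_multilinearD(4)[OF c[OF Cons.prems(1), of B]]
    by (simp_all add: twist_def)
  then show ?case
    using Cons.IH[OF c[OF Cons.prems(1)] Cons.prems(2)] Cons.IH[OF Cons.prems(1) c[OF Cons.prems(2)]]
    by (cases "q = 0") (simp_all add: lin_add lin_scale)
qed

lemma alternating_multilinear_insertion:
  assumes "lin \<psi>" "alternating_multilinear f" "alternating_multilinear Q"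
  shows "alternating_multilinear (insertion \<psi> q f Q)"
  unfolding alternating_multilinear_def using lin_insertion[OF assms] insertion_slot[OF assms] by blast

lemma hom_cochains_iff:
  "P \<in> hom_cochains scale \<alpha> n \<longleftrightarrow>
     (\<forall>As c. length As \<noteq> n \<longrightarrow> P As c = 0) \<and> alternating_multilinear P \<and>
     (\<forall>As c. \<alpha> (P As c) = P (map (map_prod \<alpha> \<alpha>) As) (\<alpha> c))" (is "?L \<longleftrightarrow> ?R")
proof
  assume L: ?L
  then have zero: "P As c = 0" if "length As \<noteq> n" for As c
    using that unfolding hom_cochains_def by blast
  have "lin (P As)" for As
  proof (cases "length As = n")
    case False
    then have "P As = (\<lambda>c. 0)" by (simp add: fun_eq_iff zero)
    then show ?thesis by (simp only: lin_zero)
  qed (use L in \<open>simp add: hom_cochains_def\<close>)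
  moreover have "lin (\<lambda>x. P (As @ (x, y) # Bs) c) \<and> lin (\<lambda>x. P (As @ (y, x) # Bs) c) \<and>
        P (As @ (y, y) # Bs) c = 0" for As Bs y c
  proof (cases "length (As @ (y, y) # Bs) = n")
    case True
    then have i: "length As < n" by simp
    have "lin (\<lambda>x. P ((As @ (y, y) # Bs)[length As := (x, y)]) c) \<and>
      lin (\<lambda>x. P ((As @ (y, y) # Bs)[length As := (y, x)]) c) \<and>
        P ((As @ (y, y) # Bs)[length As := (y, y)]) c = 0"
      using L i True unfolding hom_cochains_def by blast
    then show ?thesis by simp
  next
    case False
    then show ?thesis by (simp add: zero lin_zero)
  qed
  moreover have "\<alpha> (P As c) = P (map (map_prod \<alpha> \<alpha>) As) (\<alpha> c)" for As c
    using L lin_zero_arg[OF lin_twist] unfolding hom_cochains_def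
    by (cases "length As = n") (simp_all add: zero)
  ultimately show ?R using zero unfolding alternating_multilinear_def by blast
next
  assume R: ?R
  have "lin (\<lambda>x. P (As[i := (x, y)]) c) \<and> lin (\<lambda>x. P (As[i := (y, x)]) c) \<and> P (As[i := (y, y)]) c = 0"
    if "length As = n" "i < n" for As i y c
    using R that alternating_multilinearD(2-4)[of P] by (simp add: upd_conv_take_nth_drop)
  moreover have "lin (P As)" for As
    using R alternating_multilinearD(1) by blast
  ultimately show ?L using R unfolding hom_cochains_def by blast
qed

abbreviation C :: "nat \<Rightarrow> 'v cochain set" where "C \<equiv> hom_cochains scale \<alpha>"

lemma vector_space_cochain_scale: "vector_space (cochain_scale scale :: 'k \<Rightarrow> 'v cochain \<Rightarrow> 'v cochain)"
  by (simp add: vector_space_def fun_eq_iff cochain_scale_def scale_right_distrib scale_left_distrib)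

lemma hom_cochainD:
  assumes "P \<in> C n"
  shows "length As \<noteq> n \<Longrightarrow> P As c = 0" "alternating_multilinear P"
    "\<alpha> (P As c) = P (map (map_prod \<alpha> \<alpha>) As) (\<alpha> c)"
  using assms unfolding hom_cochains_iff by blast+

lemma hom_cochain_twist_power:
  assumes "P \<in> C n"
  shows "(\<alpha> ^^ m) (P As c) = P (map (map_prod (\<alpha> ^^ m) (\<alpha> ^^ m)) As) ((\<alpha> ^^ m) c)"
proof (induction m)
  case 0
  have "map_prod id id = (id :: 'v \<times> 'v \<Rightarrow> 'v \<times> 'v)" by (rule map_prod.id)
  then show ?case by (simp add: map_prod.identity)
next
  case (Suc m)
  then show ?case by (simp add: hom_cochainD(3)[OF assms] map_prod.comp, simp add: comp_def)
qed

lemma subspace_C: "module.subspace (cochain_scale scale) (C n)"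
proof -
  interpret CS: vector_space "cochain_scale scale :: 'k \<Rightarrow> 'v cochain \<Rightarrow> 'v cochain"
    by (rule vector_space_cochain_scale)
  have "lin \<alpha>" by (rule lin_twist)
  then have \<alpha>: "\<alpha> (x + y) = \<alpha> x + \<alpha> y" "\<alpha> (scale r x) = scale r (\<alpha> x)" "\<alpha> 0 = 0" for x y r
    using lin_zero_arg[of \<alpha>] by (simp_all add: lin_iff)
  show ?thesis
    unfolding CS.subspace_def
    by (auto simp: hom_cochains_iff alternating_multilinear_def \<alpha> cochain_scale_def lin_iff
      scale_right_distrib scale_left_commute ac_simps)
qed

lemma hlts_circ_C:
  "P \<in> C p \<Longrightarrow> hlts_circ scale \<alpha> p q P Q = insertion (\<alpha> ^^ q) q P Q"
  by (rule hlts_circ_eq_insertion) (rule hom_cochainD(1))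

text \<open>Equivariance is \<open>insertion_natural\<close> with \<alpha> on both values and
  arguments, as \<alpha> commutes with its powers.\<close>

lemma insertion_C:
  assumes P: "P \<in> C p" and Q: "Q \<in> C q"
  shows "insertion (\<alpha> ^^ q) q P Q \<in> C (p + q)"
proof -
  have "\<alpha> (insertion (\<alpha> ^^ q) q P Q As c) = insertion (\<alpha> ^^ q) q P Q (map (map_prod \<alpha> \<alpha>) As) (\<alpha> c)" for As c
    by (rule insertion_natural[OF lin_twist]) (simp_all add: hom_cochainD(3)[OF P] hom_cochainD(3)[OF Q] funpow_swap1)
  then show ?thesis
    unfolding hom_cochains_iff
    using insertion_vanishes[of p P _ q] hom_cochainD(1)[OF P]
      alternating_multilinear_insertion[OF lin_twist_power hom_cochainD(2)[OF P] hom_cochainD(2)[OF Q]] by blast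
qed

lemma insertion_C_commute:
  assumes "P \<in> C p" "Q \<in> C q"
  shows "insertion (\<alpha> ^^ p) p Q P \<in> C (p + q)"
  using insertion_C[OF assms(2,1)] by (simp add: add.commute)

text \<open>The difference is written as a sum with a negated scalar so that the additivity and
  scaling rules for \<open>insertion\<close> apply.\<close>

lemma hlts_bracket_C:
  assumes "P \<in> C p" "Q \<in> C q"
  shows "hlts_bracket scale \<alpha> p q P Q =
    insertion (\<alpha> ^^ q) q P Q + cochain_scale scale (- ((-1) ^ (p * q))) (insertion (\<alpha> ^^ p) p Q P)"
  using assms by (simp add: hlts_bracket_def hlts_circ_C) (simp add: fun_eq_iff cochain_scale_def)

lemma hlts_bracket_closed:
  assumes "P \<in> C p" "Q \<in> C q"
  shows "hlts_bracket scale \<alpha> p q P Q \<in> C (p + q)"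
proof -
  interpret CS: vector_space "cochain_scale scale :: 'k \<Rightarrow> 'v cochain \<Rightarrow> 'v cochain"
    by (rule vector_space_cochain_scale)
  show ?thesis
    unfolding hlts_bracket_C[OF assms]
    by (intro CS.subspace_add CS.subspace_scale subspace_C insertion_C insertion_C_commute assms)
qed

text \<open>Equivariant cochains are their own companions. One double product is isolated to give a
  rewrite rule.\<close>

lemma insertion_pre_Lie_C:
  assumes "P \<in> C p" "Q \<in> C q" "R \<in> C r"
  shows "insertion (\<alpha> ^^ r) r (insertion (\<alpha> ^^ q) q P Q) R As c =
      insertion (\<alpha> ^^ (q + r)) (q + r) P (insertion (\<alpha> ^^ r) r Q R) As c +
    scale ((-1) ^ (q * r)) (insertion (\<alpha> ^^ q) q (insertion (\<alpha> ^^ r) r P R) Q As c -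
      insertion (\<alpha> ^^ (q + r)) (q + r) P (insertion (\<alpha> ^^ q) q R Q) As c)"
proof -
  have comm: "(\<alpha> ^^ r) ((\<alpha> ^^ q) x) = (\<alpha> ^^ q) ((\<alpha> ^^ r) x)" for x
    by (metis add.commute comp_apply funpow_add)
  show ?thesis
    using insertion_pre_Lie[OF funpow_add comm hom_cochainD(2)[OF assms(1)], of Q Q R R q r As c]
      hom_cochain_twist_power[OF assms(2)] hom_cochain_twist_power[OF assms(3)] hom_cochainD(1)[OF assms(2)] hom_cochainD(1)[OF assms(3)]
    by (simp add: diff_eq_eq add.commute)
qed

lemma insertion_add_left_fun:
    "insertion \<psi> q (f + g) Q = insertion \<psi> q f Q + insertion \<psi> q g Q"
  and insertion_scale_left_fun:
    "insertion \<psi> q (cochain_scale scale r f) Q = cochain_scale scale r (insertion \<psi> q f Q)"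
  by (simp_all add: fun_eq_iff insertion_add_left insertion_scale_left cochain_scale_apply)

lemma insertion_add_right_fun:
    "alternating_multilinear f \<Longrightarrow> insertion \<psi> q f (Q + R) = insertion \<psi> q f Q + insertion \<psi> q f R"
  and insertion_scale_right_fun:
    "alternating_multilinear f \<Longrightarrow>
      insertion \<psi> q f (cochain_scale scale r Q) = cochain_scale scale r (insertion \<psi> q f Q)"
  by (simp_all add: fun_eq_iff insertion_add_right insertion_scale_right cochain_scale_apply)

lemmas insertion_bilinear = insertion_add_left_fun insertion_scale_left_fun
  insertion_add_right_fun insertion_scale_right_fun

text \<open>The graded commutator of a pre-Lie product satisfies the Jacobi identity: one instance
  of the pre-Lie identity for each choice of outermost cochain cancels all double products.\<close>

lemma hlts_bracket_jacobi:
  assumes a: "a \<in> C i" and b: "b \<in> C j" and c: "c \<in> C k"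
  shows "hlts_bracket scale \<alpha> i (j + k) a (hlts_bracket scale \<alpha> j k b c) =
    hlts_bracket scale \<alpha> (i + j) k (hlts_bracket scale \<alpha> i j a b) c +
    cochain_scale scale ((-1) ^ (i * j)) (hlts_bracket scale \<alpha> j (i + k) b (hlts_bracket scale \<alpha> i k a c))"
proof (intro ext)
  fix As x
  note outer = hlts_bracket_C[OF a hlts_bracket_closed[OF b c]] hlts_bracket_C[OF hlts_bracket_closed[OF a b] c]
    hlts_bracket_C[OF b hlts_bracket_closed[OF a c]]
  note inner = hlts_bracket_C[OF a b] hlts_bracket_C[OF a c] hlts_bracket_C[OF b c]
  note pre_Lie = insertion_pre_Lie_C[OF a b c] insertion_pre_Lie_C[OF b a c] insertion_pre_Lie_C[OF c a b]
  note linear = insertion_bilinear hom_cochainD(2)[OF a] hom_cochainD(2)[OF b] hom_cochainD(2)[OF c]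
  show "hlts_bracket scale \<alpha> i (j + k) a (hlts_bracket scale \<alpha> j k b c) As x =
    (hlts_bracket scale \<alpha> (i + j) k (hlts_bracket scale \<alpha> i j a b) c +
    cochain_scale scale ((-1) ^ (i * j)) (hlts_bracket scale \<alpha> j (i + k) b (hlts_bracket scale \<alpha> i k a c))) As x"
    unfolding outer unfolding inner
    by (cases "even i"; cases "even j"; cases "even k")
       (simp_all add: linear pre_Lie cochain_scale_apply add.commute mult.commute add_mult_distrib power_add
         scale_right_distrib scale_right_diff_distrib algebra_simps)
qed

lemma graded_lie_algebra_C: "graded_lie_algebra (cochain_scale scale) C (hlts_bracket scale \<alpha>)"
proof -
  interpret CS: vector_space "cochain_scale scale :: 'k \<Rightarrow> 'v cochain \<Rightarrow> 'v cochain"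
    by (rule vector_space_cochain_scale)
  have add: "P + Q \<in> C n" if "P \<in> C n" "Q \<in> C n" for P Q n
    using that CS.subspace_add[OF subspace_C] by blast
  have scl: "cochain_scale scale r P \<in> C n" if "P \<in> C n" for P r n
    using that CS.subspace_scale[OF subspace_C] by blast
  show ?thesis
  proof
    fix i j P P' Q Q' r
    show "module.subspace (cochain_scale scale) (C i)" by (rule subspace_C)
    show "P \<in> C i \<Longrightarrow> Q \<in> C j \<Longrightarrow> hlts_bracket scale \<alpha> i j P Q \<in> C (i + j)"
      by (rule hlts_bracket_closed)
    show "P \<in> C i \<Longrightarrow> P' \<in> C i \<Longrightarrow> Q \<in> C j \<Longrightarrow>
      hlts_bracket scale \<alpha> i j (P + P') Q = hlts_bracket scale \<alpha> i j P Q + hlts_bracket scale \<alpha> i j P' Q"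
      by (simp add: hlts_bracket_C add insertion_bilinear hom_cochainD(2) CS.scale_right_distrib ac_simps)
    show "P \<in> C i \<Longrightarrow> Q \<in> C j \<Longrightarrow>
      hlts_bracket scale \<alpha> i j (cochain_scale scale r P) Q = cochain_scale scale r (hlts_bracket scale \<alpha> i j P Q)"
      by (simp add: hlts_bracket_C scl insertion_bilinear hom_cochainD(2) CS.scale_right_distrib
          CS.scale_right_diff_distrib ac_simps)
    show "P \<in> C i \<Longrightarrow> Q \<in> C j \<Longrightarrow> Q' \<in> C j \<Longrightarrow>
      hlts_bracket scale \<alpha> i j P (Q + Q') = hlts_bracket scale \<alpha> i j P Q + hlts_bracket scale \<alpha> i j P Q'"
      by (simp add: hlts_bracket_C add insertion_bilinear hom_cochainD(2) CS.scale_right_distrib ac_simps)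
    show "P \<in> C i \<Longrightarrow> Q \<in> C j \<Longrightarrow>
      hlts_bracket scale \<alpha> i j P (cochain_scale scale r Q) = cochain_scale scale r (hlts_bracket scale \<alpha> i j P Q)"
      by (simp add: hlts_bracket_C scl insertion_bilinear hom_cochainD(2) CS.scale_right_distrib
          CS.scale_right_diff_distrib ac_simps)
    show "P \<in> C i \<Longrightarrow> Q \<in> C j \<Longrightarrow>
      hlts_bracket scale \<alpha> i j P Q = - cochain_scale scale ((-1) ^ (i * j)) (hlts_bracket scale \<alpha> j i Q P)"
      by (cases "even (i * j)") (simp_all add: hlts_bracket_C mult.commute[of j i])
  qed (rule hlts_bracket_jacobi)
qed

text \<open>With zero differential the Leibniz rule only asks that brackets with \<open>0\<close>
  vanish, which is homogeneity for the scalar \<open>0\<close>.\<close>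

lemma dg_lie_algebra_C_zero:
  "dg_lie_algebra (cochain_scale scale) C (hlts_bracket scale \<alpha>) (\<lambda>_ _. 0)"
proof -
  interpret G: graded_lie_algebra "cochain_scale scale" C "hlts_bracket scale \<alpha>"
    by (rule graded_lie_algebra_C)
  have "hlts_bracket scale \<alpha> i j 0 Q = 0" if "Q \<in> C j" for i j Q
    using G.br_scale_left[of 0 i Q j 0] that G.subspace_0[OF subspace_C] by simp
  moreover have "hlts_bracket scale \<alpha> i j P 0 = 0" if "P \<in> C i" for i j P
    using G.br_scale_right[of P i 0 j 0] that G.subspace_0[OF subspace_C] by simp
  ultimately show ?thesis
    by unfold_locales (simp_all add: G.subspace_0[OF subspace_C])
qed

lemma bidg_maurer_cartan_zero_iff:
  assumes "\<pi>1 \<in> C 1" "\<pi>2 \<in> C 1"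
  shows "bidg_maurer_cartan (cochain_scale scale) C (hlts_bracket scale \<alpha>) (\<lambda>_ _. 0) (\<lambda>_ _. 0) \<pi>1 \<pi>2 \<longleftrightarrow>
    hlts_bracket scale \<alpha> 1 1 \<pi>1 \<pi>1 = 0 \<and> hlts_bracket scale \<alpha> 1 1 \<pi>2 \<pi>2 = 0 \<and>
    hlts_bracket scale \<alpha> 1 1 \<pi>1 \<pi>2 = 0"
proof -
  interpret D: dg_lie_algebra "cochain_scale scale" C "hlts_bracket scale \<alpha>" "\<lambda>_ _. 0"
    by (rule dg_lie_algebra_C_zero)
  have "bidg_lie_algebra (cochain_scale scale) C (hlts_bracket scale \<alpha>) (\<lambda>_ _. 0) (\<lambda>_ _. 0)"
    by unfold_locales simp
  moreover have "dg_maurer_cartan (cochain_scale scale) C (hlts_bracket scale \<alpha>) (\<lambda>_ _. 0) \<pi> \<longleftrightarrow>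
      hlts_bracket scale \<alpha> 1 1 \<pi> \<pi> = 0" if "\<pi> \<in> C 1" for \<pi>
    using that D.dg_lie_algebra_axioms
    by (simp add: dg_maurer_cartan_def dg_maurer_cartan_axioms_def)
  ultimately show ?thesis
    using assms by (simp add: bidg_maurer_cartan_def bidg_maurer_cartan_axioms_def)
qed

text \<open>For \<open>p = q = 1\<close> the sign in front of the second product becomes positive,
  so the bracket is symmetric and polarises the fundamental identity.\<close>

lemma hlts_bracket_degree_one:
  assumes "P \<in> C 1" "Q \<in> C 1"
  shows "hlts_bracket scale \<alpha> 1 1 P Q [(a, b), (x, y)] z =
    - P [(\<alpha> a, \<alpha> b)] (Q [(x, y)] z) + P [(\<alpha> x, \<alpha> y)] (Q [(a, b)] z)
    + P [(\<alpha> x, Q [(a, b)] y)] (\<alpha> z) + P [(Q [(a, b)] x, \<alpha> y)] (\<alpha> z)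
    - Q [(\<alpha> a, \<alpha> b)] (P [(x, y)] z) + Q [(\<alpha> x, \<alpha> y)] (P [(a, b)] z)
    + Q [(\<alpha> x, P [(a, b)] y)] (\<alpha> z) + Q [(P [(a, b)] x, \<alpha> y)] (\<alpha> z)"
  unfolding hlts_bracket_C[OF assms]
  by (simp add: contract_def twist_def cochain_scale_def)


section \<open>Vanishing brackets in degree one as the triple system identities\<close>

subsection \<open>Degree one\<close>

text \<open>The bracket has degree two, so it vanishes anyway on lists of any other length.\<close>

lemma hlts_bracket_degree_one_eq_0_iff:
  assumes "P \<in> C 1" "Q \<in> C 1"
  shows "hlts_bracket scale \<alpha> 1 1 P Q = 0 \<longleftrightarrow>
    (\<forall>a b x y z. hlts_bracket scale \<alpha> 1 1 P Q [(a, b), (x, y)] z = 0)" (is "?B = 0 \<longleftrightarrow> ?R")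
proof
  assume ?R
  show "?B = 0"
  proof (intro ext)
    fix As z
    show "?B As z = 0 As z"
    proof (cases "length As = 2")
      case True
      then obtain A A' where "As = [A, A']"
        by (auto simp: numeral_2_eq_2 length_Suc_conv)
      then show ?thesis using \<open>?R\<close> by (cases A; cases A') simp
    next
      case False
      then show ?thesis using hom_cochainD(1)[OF hlts_bracket_closed[OF assms]] by simp
    qed
  qed
qed simp

text \<open>All axioms but the fundamental identity come from membership in \<open>C 1\<close> and
  the cyclic condition; the bracket is twice the defect of that identity.\<close>

lemma hom_lie_triple_system_iff_bracket:
  assumes "\<pi> \<in> C 1"
    and cyc: "\<And>a b c. trilinear_of \<pi> a b c + trilinear_of \<pi> b c a + trilinear_of \<pi> c a b = 0"
  shows "hom_lie_triple_system scale \<alpha> (trilinear_of \<pi>) \<longleftrightarrow> hlts_bracket scale \<alpha> 1 1 \<pi> \<pi> = 0"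
proof -
  let ?T = "trilinear_of \<pi>"
  have \<pi>: "alternating_multilinear \<pi>" by (rule hom_cochainD(2)[OF assms(1)])
  have lin: "lin (\<lambda>x. ?T x y z)" "lin (\<lambda>y. ?T x y z)" "lin (\<lambda>z. ?T x y z)" for x y z
    using alternating_multilinearD(1)[OF \<pi>, of "[(x, y)]"] alternating_multilinearD(2,3)[OF \<pi>, of "[]" _ "[]"]
    by (simp_all add: trilinear_of_def)
  have skew: "?T x y z + ?T y x z = 0" for x y z
    using fun_cong[OF fun_cong[OF contract_skew[OF \<pi>, of x y], of "[]"], of z]
    by (simp add: contract_def trilinear_of_def)
  have mult: "\<alpha> (?T x y z) = ?T (\<alpha> x) (\<alpha> y) (\<alpha> z)" for x y z
    by (simp add: trilinear_of_def hom_cochainD(3)[OF assms(1)])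
  have cyclic: "?T x y z + ?T z x y + ?T y z x = 0" for x y z
    using cyc[of x y z] by (simp add: ac_simps)
  \<comment> \<open>Characteristic zero enters here, to remove the factor two.\<close>
  have double: "u + u = 0 \<longleftrightarrow> u = 0" for u :: 'v
  proof -
    have "scale 2 u = u + u"
      using scale_left_distrib[of 1 1 u] by simp
    then show ?thesis by (metis scale_eq_0_iff zero_neq_numeral)
  qed
  have "hlts_bracket scale \<alpha> 1 1 \<pi> \<pi> [(a, b), (x, y)] z = 0 \<longleftrightarrow>
      ?T (\<alpha> a) (\<alpha> b) (?T x y z) =
         ?T (?T a b x) (\<alpha> y) (\<alpha> z) + ?T (\<alpha> x) (?T a b y) (\<alpha> z) + ?T (\<alpha> x) (\<alpha> y) (?T a b z)"
    (is "_ \<longleftrightarrow> ?l = ?r") for a b x y z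
  proof -
    have "hlts_bracket scale \<alpha> 1 1 \<pi> \<pi> [(a, b), (x, y)] z = (?r - ?l) + (?r - ?l)"
      unfolding hlts_bracket_degree_one[OF assms(1,1)] trilinear_of_def by (simp add: algebra_simps)
    then show ?thesis by (simp only: double right_minus_eq eq_commute[of ?l])
  qed
  then show ?thesis
    unfolding hlts_bracket_degree_one_eq_0_iff[OF assms(1,1)]
      hom_lie_triple_system_def hom_lie_triple_system_axioms_def
    using hom_vector_space_axioms lin skew mult cyclic by simp
qed

text \<open>The mixed bracket is exactly the defect of the compatibility condition, without the
  factor two.\<close>

lemma compatible_hom_lie_triple_system_iff_brackets:
  assumes "\<pi>1 \<in> C 1" "\<pi>2 \<in> C 1"
    and "\<And>a b c. trilinear_of \<pi>1 a b c + trilinear_of \<pi>1 b c a + trilinear_of \<pi>1 c a b = 0"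
    and "\<And>a b c. trilinear_of \<pi>2 a b c + trilinear_of \<pi>2 b c a + trilinear_of \<pi>2 c a b = 0"
  shows "compatible_hom_lie_triple_system scale (trilinear_of \<pi>1) (trilinear_of \<pi>2) \<alpha> \<longleftrightarrow>
    hlts_bracket scale \<alpha> 1 1 \<pi>1 \<pi>1 = 0 \<and> hlts_bracket scale \<alpha> 1 1 \<pi>2 \<pi>2 = 0 \<and>
    hlts_bracket scale \<alpha> 1 1 \<pi>1 \<pi>2 = 0"
proof -
  let ?S = "trilinear_of \<pi>1" and ?T = "trilinear_of \<pi>2"
  have "hlts_bracket scale \<alpha> 1 1 \<pi>1 \<pi>2 [(a, b), (x, y)] z = 0 \<longleftrightarrow>
      ?S (\<alpha> a) (\<alpha> b) (?T x y z) + ?T (\<alpha> a) (\<alpha> b) (?S x y z) =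
       ?T (?S a b x) (\<alpha> y) (\<alpha> z) + ?S (?T a b x) (\<alpha> y) (\<alpha> z) +
       ?T (\<alpha> x) (?S a b y) (\<alpha> z) + ?S (\<alpha> x) (?T a b y) (\<alpha> z) +
       ?T (\<alpha> x) (\<alpha> y) (?S a b z) + ?S (\<alpha> x) (\<alpha> y) (?T a b z)"
    (is "_ \<longleftrightarrow> ?l = ?r") for a b x y z
  proof -
    have "hlts_bracket scale \<alpha> 1 1 \<pi>1 \<pi>2 [(a, b), (x, y)] z = ?r - ?l"
      unfolding hlts_bracket_degree_one[OF assms(1,2)] trilinear_of_def by (simp add: algebra_simps)
    then show ?thesis by (simp only: right_minus_eq eq_commute[of ?l])
  qed
  then show ?thesis
    unfolding compatible_hom_lie_triple_system_def compatible_hom_lie_triple_system_axioms_def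
      hom_lie_triple_system_iff_bracket[OF assms(1,3)] hom_lie_triple_system_iff_bracket[OF assms(2,4)]
      hlts_bracket_degree_one_eq_0_iff[OF assms(1,2)]
    by simp
qed

end

theorem proposition2p15:
  fixes scale :: "'k::field_char_0 \<Rightarrow> 'v::ab_group_add \<Rightarrow> 'v"
    and \<alpha> :: "'v \<Rightarrow> 'v"
    and \<pi>1 \<pi>2 :: "'v cochain"
  assumes "hom_vector_space scale \<alpha>"
    and "\<pi>1 \<in> hom_cochains scale \<alpha> 1"
    and "\<pi>2 \<in> hom_cochains scale \<alpha> 1"
    and "\<And>a b c. trilinear_of \<pi>1 a b c + trilinear_of \<pi>1 b c a + trilinear_of \<pi>1 c a b = 0"
    and "\<And>a b c. trilinear_of \<pi>2 a b c + trilinear_of \<pi>2 b c a + trilinear_of \<pi>2 c a b = 0"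
  shows "compatible_hom_lie_triple_system scale (trilinear_of \<pi>1) (trilinear_of \<pi>2) \<alpha> \<longleftrightarrow>
    bidg_maurer_cartan (cochain_scale scale) (hom_cochains scale \<alpha>) (hlts_bracket scale \<alpha>)
      (\<lambda>_ _. 0) (\<lambda>_ _. 0) \<pi>1 \<pi>2"
proof -
  interpret hom_vector_space scale \<alpha> by (rule assms(1))
  show ?thesis
    unfolding compatible_hom_lie_triple_system_iff_brackets[OF assms(2-5)]
      bidg_maurer_cartan_zero_iff[OF assms(2,3)] ..
qed

end
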